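(* (i) If $M$ satisfies condition (A), then $T=\mathrm{Th}(M)$ is simple and low. (ii) If $M$ satisfies (A) and $(\mathrm{DC}_L)$, then $M$ satisfies $(\mathrm{FMV})$.
   Context: Setting: $L$ is a countable first-order language and $\mathcal C$ an infinite class of finite $L$-structures. Let $L^+$ be the two-sorted language with a sort $\mathbf D$ carrying $L$, a sort $\mathbf{OF}$ carrying the language of ordered fields with a symbol for $\log$, and for each $L$-formula $\phi(\bar x,\bar y)$ ($|\bar x|=r$, $|\bar y|=s$) a function symbol $f_\phi:\mathbf D^s\to\mathbf{OF}$. Each $N\in\mathcal C$ becomes an $L^+$-structure with $\mathbf D$-sort $N$, $\mathbf{OF}$-sort $(\mathbb R,<,+,\cdot,-,0,1,\log)$ and $f_\phi(\bar a)=|\phi(N^r,\bar a)|$. $K^*$ is an ultraproduct of these over a non-principal ultrafilter; its $\mathbf{OF}$-sort is a non-archimedean real closed field $\mathbb R^*$; $M$ is the $L$-structure induced on the $\mathbf D$-sort (infinite and $\omega_1$-saturated), $T=\mathrm{Th}(M)$. For a definable $X=\phi(M^r,\bar a)$ put $|X|=f_\phi(\bar a)$. With $C$ the convex hull of $\mathbb Z$ in $\mathbb R^*$, the pseudofinite dimension is $\delta(X)=\log|X|+C\in\mathbb R^*/C$. For a partial type (or $\bigwedge$-definable set) $X$, $\delta(X)=\inf\{\delta(D): D\supseteq X\text{ definable}\}$, computed in the ordered semigroup of cuts of $\mathbb R^*/C$. Condition (A): for every $L$-formula $\phi(\bar x,\bar y)$ there is no sequence $(p_i)_{i\in\omega}$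 of finite consistent sets of instances $\phi(\bar x,\bar a)$ ($\bar a$ from $M$) with $p_i\subseteq p_{i+1}$ and $\delta(p_i)>\delta(p_{i+1})$ for all $i$. Condition $(\mathrm{DC}_L)$: for all $L$-formulas $\phi(\bar x,\bar y)$, $\psi(\bar x,\bar z)$ there is an $L$-formula $\chi(\bar y,\bar z)$ such that for all $\bar a,\bar b$ in $M$, $M\models\chi(\bar a,\bar b)$ iff $\delta(\phi(\bar x,\bar a))\le\delta(\psi(\bar x,\bar b))$. Condition $(\mathrm{FMV})$: for every $L$-formula $\phi(\bar x,\bar y)$ with $|\bar x|=r$, the set $\{\delta(\phi(M^r,\bar b)):\bar b\in M^{s}\}$ is finite. A simple theory is low if for every formula $\phi$ there is $n_\phi<\omega$ such that there is no dividing $\phi$-chain of length $n_\phi$ (a dividing chain of length $\alpha$ for $\phi$ is a sequence $(\bar a_i)_{i<\alpha}$ with $\bigcup_i\{\phi(\bar x,\bar a_i)\}$ consistent and $\phi(\bar x,\bar a_i)$ dividing over $\{\bar a_j:j<i\}$ for all $i$). *)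

theory Defs
  imports Complex_Main "HOL-Library.Countable_Set"
begin

section \<open>First-order languages and structures\<close>

record ('f, 'r) language =
  fun_syms :: "'f set"
  rel_syms :: "'r set"
  fun_arity :: "'f \<Rightarrow> nat"
  rel_arity :: "'r \<Rightarrow> nat"

record ('f, 'r, 'a) struct =
  univ :: "'a set"
  fun_int :: "'f \<Rightarrow> 'a list \<Rightarrow> 'a"
  rel_int :: "'r \<Rightarrow> 'a list \<Rightarrow> bool"

datatype 'f tm = Var nat | App 'f "'f tm list"

text \<open>Variables are de Bruijn indices into a list of values; a quantifier prepends the
  witness to that list. The remaining connectives and the universal quantifier are definable.\<close>

datatype ('f, 'r) fm =
    FEq "'f tm" "'f tm"
  | FRel 'r "'f tm list"
  | FNeg "('f, 'r) fm"
  | FConj "('f, 'r) fm" "('f, 'r) fm"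
  | FEx "('f, 'r) fm"

definition countable_language :: "('f, 'r) language \<Rightarrow> bool" where
  "countable_language L \<longleftrightarrow> countable (fun_syms L) \<and> countable (rel_syms L)"

definition tuples :: "('f, 'r, 'a) struct \<Rightarrow> nat \<Rightarrow> 'a list set" where
  "tuples N n = {v. length v = n \<and> set v \<subseteq> univ N}"

definition is_structure :: "('f, 'r) language \<Rightarrow> ('f, 'r, 'a) struct \<Rightarrow> bool" where
  "is_structure L N \<longleftrightarrow> univ N \<noteq> {} \<and>
     (\<forall>f\<in>fun_syms L. \<forall>v\<in>tuples N (fun_arity L f). fun_int N f v \<in> univ N)"

text \<open>\<open>is_fmla L n \<phi>\<close>: \<open>\<phi>\<close> is an \<open>L\<close>-formula whose free variables are among the first \<open>n\<close>.\<close>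

fun is_tm :: "('f, 'r) language \<Rightarrow> nat \<Rightarrow> 'f tm \<Rightarrow> bool" where
  "is_tm L n (Var i) \<longleftrightarrow> i < n"
| "is_tm L n (App f ts) \<longleftrightarrow>
     f \<in> fun_syms L \<and> length ts = fun_arity L f \<and> (\<forall>t\<in>set ts. is_tm L n t)"

fun is_fmla :: "('f, 'r) language \<Rightarrow> nat \<Rightarrow> ('f, 'r) fm \<Rightarrow> bool" where
  "is_fmla L n (FEq t u) \<longleftrightarrow> is_tm L n t \<and> is_tm L n u"
| "is_fmla L n (FRel R ts) \<longleftrightarrow>
     R \<in> rel_syms L \<and> length ts = rel_arity L R \<and> (\<forall>t\<in>set ts. is_tm L n t)"
| "is_fmla L n (FNeg \<phi>) \<longleftrightarrow> is_fmla L n \<phi>"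
| "is_fmla L n (FConj \<phi> \<psi>) \<longleftrightarrow> is_fmla L n \<phi> \<and> is_fmla L n \<psi>"
| "is_fmla L n (FEx \<phi>) \<longleftrightarrow> is_fmla L (Suc n) \<phi>"

fun tm_val :: "('f, 'r, 'a) struct \<Rightarrow> 'a list \<Rightarrow> 'f tm \<Rightarrow> 'a" where
  "tm_val N e (Var i) = e ! i"
| "tm_val N e (App f ts) = fun_int N f (map (tm_val N e) ts)"

fun sat :: "('f, 'r, 'a) struct \<Rightarrow> 'a list \<Rightarrow> ('f, 'r) fm \<Rightarrow> bool" where
  "sat N e (FEq t u) \<longleftrightarrow> tm_val N e t = tm_val N e u"
| "sat N e (FRel R ts) \<longleftrightarrow> rel_int N R (map (tm_val N e) ts)"
| "sat N e (FNeg \<phi>) \<longleftrightarrow> \<not> sat N e \<phi>"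
| "sat N e (FConj \<phi> \<psi>) \<longleftrightarrow> sat N e \<phi> \<and> sat N e \<psi>"
| "sat N e (FEx \<phi>) \<longleftrightarrow> (\<exists>a\<in>univ N. sat N (a # e) \<phi>)"

text \<open>A partitioned formula \<open>\<phi>(x,y)\<close> with \<open>|x| = r\<close> and \<open>|y| = s\<close> is a \<open>\<phi>\<close> with
  \<open>is_fmla L (r + s) \<phi>\<close>; the variables \<open>x\<close> come first. \<open>def_set N r \<phi> b\<close> is the set \<open>\<phi>(N\<^sup>r,b)\<close>.\<close>

definition def_set :: "('f, 'r, 'a) struct \<Rightarrow> nat \<Rightarrow> ('f, 'r) fm \<Rightarrow> 'a list \<Rightarrow> 'a list set" where
  "def_set N r \<phi> b = {v \<in> tuples N r. sat N (v @ b) \<phi>}"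

definition Th :: "('f, 'r) language \<Rightarrow> ('f, 'r, 'a) struct \<Rightarrow> ('f, 'r) fm set" where
  "Th L N = {\<phi>. is_fmla L 0 \<phi> \<and> sat N [] \<phi>}"

definition is_model :: "('f, 'r) language \<Rightarrow> ('f, 'r) fm set \<Rightarrow> ('f, 'r, 'a) struct \<Rightarrow> bool" where
  "is_model L T N \<longleftrightarrow> is_structure L N \<and> (\<forall>\<phi>\<in>T. sat N [] \<phi>)"


section \<open>Simple and low theories\<close>

text \<open>A set of instances \<open>{\<phi>(x,b) | b \<in> B}\<close> is represented by its set \<open>B\<close> of parameters.
  Consistency with the elementary diagram of \<open>N\<close> amounts to finite satisfiability in \<open>N\<close>.\<close>

definition solutions :: "('f, 'r, 'a) struct \<Rightarrow> nat \<Rightarrow> ('f, 'r) fm \<Rightarrow> 'a list set \<Rightarrow> 'a list set" where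
  "solutions N r \<phi> B = {v \<in> tuples N r. \<forall>b\<in>B. sat N (v @ b) \<phi>}"

definition consistent :: "('f, 'r, 'a) struct \<Rightarrow> nat \<Rightarrow> ('f, 'r) fm \<Rightarrow> 'a list set \<Rightarrow> bool" where
  "consistent N r \<phi> B \<longleftrightarrow> (\<forall>F. finite F \<and> F \<subseteq> B \<longrightarrow> solutions N r \<phi> F \<noteq> {})"

definition k_inconsistent ::
  "('f, 'r, 'a) struct \<Rightarrow> nat \<Rightarrow> ('f, 'r) fm \<Rightarrow> nat \<Rightarrow> (nat \<Rightarrow> 'a list) \<Rightarrow> bool" where
  "k_inconsistent N r \<phi> k b \<longleftrightarrow>
     (\<forall>I. finite I \<and> card I = k \<longrightarrow> \<not> consistent N r \<phi> (b ` I))"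

text \<open>Nodes of the tree are finite sequences of naturals; \<open>map \<eta> [0..<n]\<close> is the restriction of
  the branch \<open>\<eta>\<close> to \<open>n\<close>.\<close>

definition tree_property :: "('f, 'r, 'a) struct \<Rightarrow> nat \<Rightarrow> nat \<Rightarrow> ('f, 'r) fm \<Rightarrow> bool" where
  "tree_property N r s \<phi> \<longleftrightarrow>
     (\<exists>k. \<exists>a :: nat list \<Rightarrow> 'a list.
        (\<forall>\<sigma>. a \<sigma> \<in> tuples N s) \<and>
        (\<forall>\<eta> :: nat \<Rightarrow> nat. consistent N r \<phi> {a (map \<eta> [0..<n]) | n. True}) \<and>
        (\<forall>\<sigma>. k_inconsistent N r \<phi> k (\<lambda>i. a (\<sigma> @ [i]))))"

text \<open>Models range over structures with elements in an arbitrary type; the type argument makes that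
  type explicit, and theorems about simplicity or lowness leave it as a type variable.\<close>

definition simple_theory ::
  "'m itself \<Rightarrow> ('f, 'r) language \<Rightarrow> ('f, 'r) fm set \<Rightarrow> bool" where
  "simple_theory _ L T \<longleftrightarrow>
     (\<forall>N :: ('f, 'r, 'm) struct. is_model L T N \<longrightarrow>
        (\<forall>r s \<phi>. is_fmla L (r + s) \<phi> \<longrightarrow> \<not> tree_property N r s \<phi>))"

text \<open>Every set of formulas in one variable over a countable parameter set that is finitely
  satisfiable in \<open>N\<close> is realised in \<open>N\<close>. A formula over \<open>A\<close> is a pair of a formula and the list of
  parameters for its variables after the first.\<close>

definition omega1_saturated :: "('f, 'r) language \<Rightarrow> ('f, 'r, 'a) struct \<Rightarrow> bool" where
  "omega1_saturated L N \<longleftrightarrow>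
     (\<forall>A \<Sigma>. countable A \<and> A \<subseteq> univ N \<and>
        (\<forall>(\<phi>, c)\<in>\<Sigma>. set c \<subseteq> A \<and> is_fmla L (1 + length c) \<phi>) \<and>
        (\<forall>F. finite F \<and> F \<subseteq> \<Sigma> \<longrightarrow> (\<exists>x\<in>univ N. \<forall>(\<phi>, c)\<in>F. sat N (x # c) \<phi>))
      \<longrightarrow> (\<exists>x\<in>univ N. \<forall>(\<phi>, c)\<in>\<Sigma>. sat N (x # c) \<phi>))"

definition same_type ::
  "('f, 'r) language \<Rightarrow> ('f, 'r, 'a) struct \<Rightarrow> 'a set \<Rightarrow> 'a list \<Rightarrow> 'a list \<Rightarrow> bool" where
  "same_type L N A a b \<longleftrightarrow> length a = length b \<and>
     (\<forall>\<psi> c. set c \<subseteq> A \<and> is_fmla L (length a + length c) \<psi> \<longrightarrow>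
        (sat N (a @ c) \<psi> \<longleftrightarrow> sat N (b @ c) \<psi>))"

text \<open>Dividing is evaluated inside \<open>N\<close>, hence has its usual meaning when \<open>N\<close> is saturated enough.
  For a countable language and the finite parameter sets below, \<open>\<omega>\<^sub>1\<close>-saturation suffices.\<close>

definition divides_over ::
  "('f, 'r) language \<Rightarrow> ('f, 'r, 'a) struct \<Rightarrow> nat \<Rightarrow> nat \<Rightarrow> ('f, 'r) fm \<Rightarrow> 'a list \<Rightarrow> 'a set \<Rightarrow> bool" where
  "divides_over L N r s \<phi> a A \<longleftrightarrow>
     (\<exists>k. \<exists>b :: nat \<Rightarrow> 'a list.
        (\<forall>i. b i \<in> tuples N s \<and> same_type L N A a (b i)) \<and> k_inconsistent N r \<phi> k b)"

definition dividing_chain ::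
  "('f, 'r) language \<Rightarrow> ('f, 'r, 'a) struct \<Rightarrow> nat \<Rightarrow> nat \<Rightarrow> ('f, 'r) fm \<Rightarrow> nat \<Rightarrow> (nat \<Rightarrow> 'a list) \<Rightarrow> bool" where
  "dividing_chain L N r s \<phi> n a \<longleftrightarrow>
     (\<forall>i<n. a i \<in> tuples N s) \<and>
     consistent N r \<phi> (a ` {..<n}) \<and>
     (\<forall>i<n. divides_over L N r s \<phi> (a i) (\<Union>j<i. set (a j)))"

text \<open>The \<open>\<omega>\<^sub>1\<close>-saturated models of \<open>T\<close> play the role of the monster model (for countable \<open>L\<close>).\<close>

definition low_theory ::
  "'m itself \<Rightarrow> ('f, 'r) language \<Rightarrow> ('f, 'r) fm set \<Rightarrow> bool" where
  "low_theory TM L T \<longleftrightarrow> simple_theory TM L T \<and>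
     (\<forall>r s \<phi>. is_fmla L (r + s) \<phi> \<longrightarrow>
        (\<exists>n. \<forall>N :: ('f, 'r, 'm) struct. is_model L T N \<and> omega1_saturated L N \<longrightarrow>
           \<not> (\<exists>a. dividing_chain L N r s \<phi> n a)))"


section \<open>Ultraproducts\<close>

definition nonprincipal_ultrafilter_on :: "'i filter \<Rightarrow> 'i set \<Rightarrow> bool" where
  "nonprincipal_ultrafilter_on U I \<longleftrightarrow>
     U \<noteq> bot \<and> U \<le> principal I \<and>
     (\<forall>P. eventually P U \<or> eventually (\<lambda>i. \<not> P i) U) \<and>
     (\<forall>i. U \<noteq> principal {i})"

definition ucls :: "'i filter \<Rightarrow> ('i \<Rightarrow> 'b) \<Rightarrow> ('i \<Rightarrow> 'b) set" where
  "ucls U g = {h. eventually (\<lambda>i. h i = g i) U}"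

definition urep :: "('i \<Rightarrow> 'b) set \<Rightarrow> 'i \<Rightarrow> 'b" where
  "urep q = (SOME g. g \<in> q)"

text \<open>The \<open>L\<close>-structure on the first sort of \<open>K\<^sup>*\<close>; each structure is its own index. Sequences
  need to lie in the product only \<open>U\<close>-almost everywhere. As structures are nonempty, this yields the
  usual ultraproduct up to the obvious identification.\<close>

definition ultraproduct ::
  "('f, 'r, 'a) struct filter \<Rightarrow> ('f, 'r, (('f, 'r, 'a) struct \<Rightarrow> 'a) set) struct" where
  "ultraproduct U =
     \<lparr>univ = {ucls U g | g. eventually (\<lambda>N. g N \<in> univ N) U},
      fun_int = (\<lambda>f v. ucls U (\<lambda>N. fun_int N f (map (\<lambda>q. urep q N) v))),
      rel_int = (\<lambda>R v. eventually (\<lambda>N. rel_int N R (map (\<lambda>q. urep q N) v)) U)\<rparr>"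

type_synonym 'i hyper = "('i \<Rightarrow> real) set"

text \<open>The sort of ordered fields of \<open>K\<^sup>*\<close>: the ultrapower \<open>\<real>\<^sup>*\<close> of \<open>\<real>\<close>.\<close>

definition hyperreals :: "'i filter \<Rightarrow> 'i hyper set" where
  "hyperreals U = range (ucls U)"

definition hle :: "'i filter \<Rightarrow> 'i hyper \<Rightarrow> 'i hyper \<Rightarrow> bool" where
  "hle U x y \<longleftrightarrow> eventually (\<lambda>i. urep x i \<le> urep y i) U"

definition hminus :: "'i filter \<Rightarrow> 'i hyper \<Rightarrow> 'i hyper \<Rightarrow> 'i hyper" where
  "hminus U x y = ucls U (\<lambda>i. urep x i - urep y i)"

definition hlog :: "'i filter \<Rightarrow> 'i hyper \<Rightarrow> 'i hyper" where
  "hlog U x = ucls U (\<lambda>i. ln (urep x i))"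

definition hconst :: "'i filter \<Rightarrow> real \<Rightarrow> 'i hyper" where
  "hconst U c = ucls U (\<lambda>_. c)"

text \<open>The convex hull \<open>C\<close> of \<open>\<int>\<close> in \<open>\<real>\<^sup>*\<close>.\<close>

definition hull_int :: "'i filter \<Rightarrow> 'i hyper set" where
  "hull_int U = {x \<in> hyperreals U.
     \<exists>m n :: int. hle U (hconst U (of_int m)) x \<and> hle U x (hconst U (of_int n))}"

definition coset :: "'i filter \<Rightarrow> 'i hyper \<Rightarrow> 'i hyper set" where
  "coset U x = {y \<in> hyperreals U. hminus U y x \<in> hull_int U}"

definition cosets :: "'i filter \<Rightarrow> 'i hyper set set" where
  "cosets U = coset U ` hyperreals U"

definition coset_le :: "'i filter \<Rightarrow> 'i hyper set \<Rightarrow> 'i hyper set \<Rightarrow> bool" where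
  "coset_le U P Q \<longleftrightarrow> (\<exists>x\<in>P. \<exists>y\<in>Q. hle U x y)"


section \<open>Pseudofinite dimension\<close>

text \<open>\<open>f\<^sub>\<phi>(a)\<close>, the nonstandard cardinality of \<open>\<phi>(M\<^sup>r,a)\<close>.\<close>

definition f_count ::
  "('f, 'r, 'a) struct filter \<Rightarrow> nat \<Rightarrow> ('f, 'r) fm \<Rightarrow>
    (('f, 'r, 'a) struct \<Rightarrow> 'a) set list \<Rightarrow> ('f, 'r, 'a) struct hyper" where
  "f_count U r \<phi> a = ucls U (\<lambda>N. real (card (def_set N r \<phi> (map (\<lambda>q. urep q N) a))))"

text \<open>Dimensions of definable sets: \<open>Some\<close> is an element of \<open>\<real>\<^sup>*/C\<close>, and \<open>None\<close> is \<open>-\<infinity> = log 0\<close>,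
  the dimension of the empty set.\<close>

type_synonym 'i dim = "'i hyper set option"

definition delta ::
  "('f, 'r, 'a) struct filter \<Rightarrow> nat \<Rightarrow> ('f, 'r) fm \<Rightarrow>
    (('f, 'r, 'a) struct \<Rightarrow> 'a) set list \<Rightarrow> ('f, 'r, 'a) struct dim" where
  "delta U r \<phi> a =
     (if f_count U r \<phi> a = hconst U 0 then None else Some (coset U (hlog U (f_count U r \<phi> a))))"

fun dim_le :: "'i filter \<Rightarrow> 'i dim \<Rightarrow> 'i dim \<Rightarrow> bool" where
  "dim_le U None _ \<longleftrightarrow> True"
| "dim_le U (Some P) None \<longleftrightarrow> False"
| "dim_le U (Some P) (Some Q) \<longleftrightarrow> coset_le U P Q"

text \<open>Cuts of \<open>\<real>\<^sup>*/C\<close> are represented by their lower parts, ordered by inclusion. A dimension \<open>d\<close> of a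
  definable set is identified with the cut \<open>{q. q \<le> d}\<close>; an infimum is an intersection of lower
  parts. In \<open>delta_set\<close>, the formula \<open>\<psi>\<close> and the parameters \<open>c\<close> run over all definable
  \<open>D = \<psi>(M\<^sup>r,c)\<close> that contain \<open>X\<close>.\<close>

definition delta_set ::
  "('f, 'r) language \<Rightarrow> ('f, 'r, 'a) struct filter \<Rightarrow> nat \<Rightarrow>
    (('f, 'r, 'a) struct \<Rightarrow> 'a) set list set \<Rightarrow> ('f, 'r, 'a) struct hyper set set" where
  "delta_set L U r X =
     {q \<in> cosets U. \<forall>\<psi> c. set c \<subseteq> univ (ultraproduct U) \<and> is_fmla L (r + length c) \<psi> \<and>
        X \<subseteq> def_set (ultraproduct U) r \<psi> c \<longrightarrow> dim_le U (Some q) (delta U r \<psi> c)}"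

definition cond_A :: "('f, 'r) language \<Rightarrow> ('f, 'r, 'a) struct filter \<Rightarrow> bool" where
  "cond_A L U \<longleftrightarrow>
     (let M = ultraproduct U in
      \<forall>r s \<phi>. is_fmla L (r + s) \<phi> \<longrightarrow>
        \<not> (\<exists>p :: nat \<Rightarrow> (('f, 'r, 'a) struct \<Rightarrow> 'a) set list set. \<forall>i.
             finite (p i) \<and> p i \<subseteq> tuples M s \<and> consistent M r \<phi> (p i) \<and>
             p i \<subseteq> p (Suc i) \<and>
             delta_set L U r (solutions M r \<phi> (p (Suc i)))
               \<subset> delta_set L U r (solutions M r \<phi> (p i))))"

definition cond_DC :: "('f, 'r) language \<Rightarrow> ('f, 'r, 'a) struct filter \<Rightarrow> bool" where
  "cond_DC L U \<longleftrightarrow>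
     (let M = ultraproduct U in
      \<forall>r s t \<phi> \<psi>. is_fmla L (r + s) \<phi> \<and> is_fmla L (r + t) \<psi> \<longrightarrow>
        (\<exists>\<chi>. is_fmla L (s + t) \<chi> \<and>
           (\<forall>a\<in>tuples M s. \<forall>b\<in>tuples M t.
              sat M (a @ b) \<chi> \<longleftrightarrow> dim_le U (delta U r \<phi> a) (delta U r \<psi> b))))"

definition cond_FMV :: "('f, 'r) language \<Rightarrow> ('f, 'r, 'a) struct filter \<Rightarrow> bool" where
  "cond_FMV L U \<longleftrightarrow>
     (\<forall>r s \<phi>. is_fmla L (r + s) \<phi> \<longrightarrow>
        finite (delta U r \<phi> ` tuples (ultraproduct U) s))"

end

theory Submission
  imports Defs
begin

text \<open>For fixed width \<open>w\<close> and inconsistency degrees \<open>k\<^sub>0, \<dots>, k\<^sub>n\<^sub>-\<^sub>1\<close>, a single sentence says that there is a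
  tree of height \<open>n\<close> and width \<open>w\<close> of instances of \<open>\<phi>\<close> whose branches are consistent and whose siblings
  at height \<open>i\<close> are \<open>k\<^sub>i\<close>-inconsistent. The tree property yields such trees, and so does a dividing chain
  of length \<open>n\<close>: each entry is replaced by \<open>w\<close> members of a sequence witnessing that it divides. By
  Los's theorem these trees also occur in almost all of the finite structures, where double
  counting gives every node a child that shrinks the solution set by a factor greater than \<open>m\<close> as
  soon as \<open>w > m k\<^sub>i\<close>. A diagonal argument turns the resulting branches, with \<open>n\<close> and \<open>m\<close> growing, into
  an infinite sequence in the ultraproduct along which \<open>\<delta>\<close> drops at each step, against (A).
  If \<open>\<phi>\<close> violates (FMV), then by (DC) the order of the values of \<open>\<delta>\<close> is a definable preorder with
  infinitely many classes, and nested subdivisions of its intervals are again such trees.\<close>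

section \<open>Formulas\<close>

fun ren_tm :: "(nat \<Rightarrow> nat) \<Rightarrow> 'f tm \<Rightarrow> 'f tm" where
  "ren_tm \<rho> (Var i) = Var (\<rho> i)"
| "ren_tm \<rho> (App f ts) = App f (map (ren_tm \<rho>) ts)"

fun ren :: "(nat \<Rightarrow> nat) \<Rightarrow> ('f, 'r) fm \<Rightarrow> ('f, 'r) fm" where
  "ren \<rho> (FEq t u) = FEq (ren_tm \<rho> t) (ren_tm \<rho> u)"
| "ren \<rho> (FRel R ts) = FRel R (map (ren_tm \<rho>) ts)"
| "ren \<rho> (FNeg \<phi>) = FNeg (ren \<rho> \<phi>)"
| "ren \<rho> (FConj \<phi> \<psi>) = FConj (ren \<rho> \<phi>) (ren \<rho> \<psi>)"
| "ren \<rho> (FEx \<phi>) = FEx (ren (case_nat 0 (\<lambda>i. Suc (\<rho> i))) \<phi>)"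

lemma is_tm_ren:
  "is_tm L n t \<Longrightarrow> (\<And>i. i < n \<Longrightarrow> \<rho> i < m) \<Longrightarrow> is_tm L m (ren_tm \<rho> t)"
  by (induction t) auto

lemma tm_val_ren:
  "is_tm L n t \<Longrightarrow> (\<And>i. i < n \<Longrightarrow> e' ! \<rho> i = e ! i) \<Longrightarrow>
    tm_val N e' (ren_tm \<rho> t) = tm_val N e t"
proof (induction t)
  case (App f ts)
  then have "map (\<lambda>t. tm_val N e' (ren_tm \<rho> t)) ts = map (tm_val N e) ts" by auto
  then show ?case by (simp add: comp_def del: map_eq_conv)
qed simp

lemma is_fmla_ren:
  "is_fmla L n \<phi> \<Longrightarrow> (\<And>i. i < n \<Longrightarrow> \<rho> i < m) \<Longrightarrow> is_fmla L m (ren \<rho> \<phi>)"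
proof (induction \<phi> arbitrary: n m \<rho>)
  case (FEx \<phi>)
  show ?case
    using FEx.prems by (auto intro!: FEx.IH[of "Suc n"] split: nat.split)
qed (auto intro: is_tm_ren)

text \<open>Only the values read through \<rho> matter, so \<rho> may be any map on indices; this
  covers at once weakening, permuting variables and picking one block out of several. Under a
  quantifier the new index 0 is fixed and the others are shifted.\<close>

lemma sat_ren:
  "is_fmla L n \<phi> \<Longrightarrow> (\<And>i. i < n \<Longrightarrow> e' ! \<rho> i = e ! i) \<Longrightarrow>
    sat N e' (ren \<rho> \<phi>) \<longleftrightarrow> sat N e \<phi>"
proof (induction \<phi> arbitrary: n e e' \<rho>)
  case (FEq t u)
  then show ?case using tm_val_ren[of L n _ e' \<rho> e N] by auto
next
  case (FRel R ts)
  then have "map (\<lambda>t. tm_val N e' (ren_tm \<rho> t)) ts = map (tm_val N e) ts"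
    using tm_val_ren[of L n _ e' \<rho> e N] by auto
  then show ?case by (simp add: comp_def del: map_eq_conv)
next
  case (FEx \<phi>)
  have "sat N (a # e') (ren (case_nat 0 (\<lambda>i. Suc (\<rho> i))) \<phi>) \<longleftrightarrow> sat N (a # e) \<phi>" for a
    using FEx.prems by (auto intro!: FEx.IH[of "Suc n"] split: nat.split)
  then show ?case by simp
next
  case (FNeg \<phi>)
  then show ?case using FNeg.IH[of n e' \<rho> e] by simp
next
  case (FConj \<phi> \<psi>)
  then show ?case using FConj.IH(1)[of n e' \<rho> e] FConj.IH(2)[of n e' \<rho> e] by simp
qed

section \<open>Blocks of quantifiers and finite conjunctions\<close>

fun exn :: "nat \<Rightarrow> ('f, 'r) fm \<Rightarrow> ('f, 'r) fm" where
  "exn 0 \<phi> = \<phi>"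
| "exn (Suc n) \<phi> = FEx (exn n \<phi>)"

lemma is_fmla_exn [simp]: "is_fmla L m (exn n \<phi>) \<longleftrightarrow> is_fmla L (n + m) \<phi>"
  by (induction n arbitrary: m) auto

lemma sat_exn: "sat N e (exn n \<phi>) \<longleftrightarrow> (\<exists>v\<in>tuples N n. sat N (v @ e) \<phi>)"
proof (induction n arbitrary: e)
  case 0
  then show ?case by (simp add: tuples_def)
next
  case (Suc n)
  \<comment> \<open>The outermost quantifier binds the last entry of the block, so the tuple is
    split at its end.\<close>
  have "sat N e (exn (Suc n) \<phi>) \<longleftrightarrow>
      (\<exists>a\<in>univ N. \<exists>v\<in>tuples N n. sat N ((v @ [a]) @ e) \<phi>)"
    by (simp add: Suc)
  also have "\<dots> \<longleftrightarrow> (\<exists>v\<in>tuples N (Suc n). sat N (v @ e) \<phi>)"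
  proof safe
    fix v assume v: "v \<in> tuples N (Suc n)" "sat N (v @ e) \<phi>"
    then show "\<exists>a\<in>univ N. \<exists>v\<in>tuples N n. sat N ((v @ [a]) @ e) \<phi>"
      by (cases v rule: rev_cases) (auto simp: tuples_def)
  next
    fix a v assume "a \<in> univ N" "v \<in> tuples N n" "sat N ((v @ [a]) @ e) \<phi>"
    then show "\<exists>v\<in>tuples N (Suc n). sat N (v @ e) \<phi>"
      by (intro bexI[of _ "v @ [a]"]) (auto simp: tuples_def)
  qed
  finally show ?case .
qed

text \<open>The empty conjunction is \<open>\<exists>x. x = x\<close>, which is true because structures are nonempty.\<close>

fun conjs :: "('f, 'r) fm list \<Rightarrow> ('f, 'r) fm" where
  "conjs [] = FEx (FEq (Var 0) (Var 0))"
| "conjs (\<phi> # \<phi>s) = FConj \<phi> (conjs \<phi>s)"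

lemma is_fmla_conjs [simp]: "is_fmla L n (conjs \<phi>s) \<longleftrightarrow> (\<forall>\<phi>\<in>set \<phi>s. is_fmla L n \<phi>)"
  by (induction \<phi>s) auto

lemma sat_conjs: "univ N \<noteq> {} \<Longrightarrow> sat N e (conjs \<phi>s) \<longleftrightarrow> (\<forall>\<phi>\<in>set \<phi>s. sat N e \<phi>)"
  by (induction \<phi>s) auto

section \<open>Finite sets of instances as one formula\<close>

lemma nth_concat_uniform:
  "\<lbrakk>\<forall>y\<in>set ys. length y = s; j < length ys; i < s\<rbrakk> \<Longrightarrow> concat ys ! (j * s + i) = ys ! j ! i"
proof (induction ys arbitrary: j)
  case (Cons y ys)
  then show ?case by (cases j) (auto simp: nth_append)
qed simp

lemma length_concat_uniform: "\<forall>y\<in>set ys. length y = s \<Longrightarrow> length (concat ys) = length ys * s"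
  by (induction ys) auto

text \<open>In \<open>sol_fm r s \<phi> J\<close> the list of values is \<open>x @ y\<^sub>0 @ y\<^sub>1 @ \<dots>\<close> with \<open>|x| = r\<close> and \<open>|y\<^sub>j| = s\<close>.\<close>

definition sol_fm :: "nat \<Rightarrow> nat \<Rightarrow> ('f, 'r) fm \<Rightarrow> nat list \<Rightarrow> ('f, 'r) fm" where
  "sol_fm r s \<phi> J = conjs (map (\<lambda>j. ren (\<lambda>v. if v < r then v else v + j * s) \<phi>) J)"

lemma is_fmla_sol_fm:
  assumes "is_fmla L (r + s) \<phi>" "\<forall>j\<in>set J. j < l"
  shows "is_fmla L (r + l * s) (sol_fm r s \<phi> J)"
proof -
  have "is_fmla L (r + l * s) (ren (\<lambda>v. if v < r then v else v + j * s) \<phi>)" if "j < l" for j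
  proof (rule is_fmla_ren[OF assms(1)])
    fix v assume v: "v < r + s"
    \<comment> \<open>Parameter block \<open>j\<close> ends at position
      \<open>r + Suc j * s\<close>.\<close>
    have "Suc j * s \<le> l * s" using that by (intro mult_le_mono1) simp
    then show "(if v < r then v else v + j * s) < r + l * s" using v by simp
  qed
  then show ?thesis using assms(2) by (simp add: sol_fm_def)
qed

lemma sat_sol_fm:
  assumes "is_fmla L (r + s) \<phi>" "\<forall>j\<in>set J. j < length ys" "\<forall>y\<in>set ys. length y = s"
    "length v = r" "univ N \<noteq> {}"
  shows "sat N (v @ concat ys) (sol_fm r s \<phi> J) \<longleftrightarrow> (\<forall>j\<in>set J. sat N (v @ ys ! j) \<phi>)"
proof -
  have "sat N (v @ concat ys) (ren (\<lambda>v. if v < r then v else v + j * s) \<phi>) \<longleftrightarrow> sat N (v @ ys ! j) \<phi>"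
    if "j \<in> set J" for j
  proof (rule sat_ren[OF assms(1)])
    fix i assume i: "i < r + s"
    show "(v @ concat ys) ! (if i < r then i else i + j * s) = (v @ ys ! j) ! i"
    proof (cases "i < r")
      case False
      then obtain i' where "i = r + i'" by (metis le_add_diff_inverse not_less)
      then show ?thesis
        using assms(2-4) i that nth_concat_uniform[of ys s j i'] by (simp add: nth_append add.commute)
    qed (use assms(4) in \<open>simp add: nth_append\<close>)
  qed
  then show ?thesis
    by (simp add: sol_fm_def sat_conjs[OF assms(5)])
qed

text \<open>Concatenating the parameters turns a finite set of instances into one definable set, to
  which Los's theorem and \<open>delta\<close> apply.\<close>

lemma solutions_eq_def_set:
  assumes "is_fmla L (r + s) \<phi>" "\<forall>y\<in>set ys. length y = s" "univ N \<noteq> {}"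
  shows "solutions N r \<phi> (set ys) = def_set N r (sol_fm r s \<phi> [0..<length ys]) (concat ys)"
proof -
  have "sat N (v @ concat ys) (sol_fm r s \<phi> [0..<length ys]) \<longleftrightarrow> (\<forall>y\<in>set ys. sat N (v @ y) \<phi>)"
    if "length v = r" for v
    using sat_sol_fm[OF assms(1) _ assms(2) that assms(3), of "[0..<length ys]"]
    by (auto simp: all_set_conv_all_nth)
  then show ?thesis by (auto simp: solutions_def def_set_def tuples_def)
qed

lemma ex_solution_iff_sat:
  assumes "is_fmla L (r + s) \<phi>" "\<forall>j\<in>set J. j < length ys" "\<forall>y\<in>set ys. length y = s"
    "univ N \<noteq> {}"
  shows "sat N (concat ys) (exn r (sol_fm r s \<phi> J)) \<longleftrightarrow> solutions N r \<phi> ((!) ys ` set J) \<noteq> {}"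
proof -
  have "(\<exists>v\<in>tuples N r. sat N (v @ concat ys) (sol_fm r s \<phi> J)) \<longleftrightarrow>
      (\<exists>v\<in>tuples N r. \<forall>j\<in>set J. sat N (v @ ys ! j) \<phi>)"
    by (intro bex_cong refl sat_sol_fm[OF assms(1-3) _ assms(4)]) (simp add: tuples_def)
  then show ?thesis by (auto simp: sat_exn solutions_def)
qed

section \<open>Finite trees of inconsistent families\<close>

text \<open>\<open>ys\<close> lists the labels on the path from the current node back to the root.\<close>

fun has_tree :: "('f, 'r, 'a) struct \<Rightarrow> nat \<Rightarrow> nat \<Rightarrow> ('f, 'r) fm \<Rightarrow> nat \<Rightarrow> nat list \<Rightarrow>
    'a list list \<Rightarrow> bool" where
  "has_tree N r s \<phi> w [] ys \<longleftrightarrow> solutions N r \<phi> (set ys) \<noteq> {}"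
| "has_tree N r s \<phi> w (k # ks) ys \<longleftrightarrow>
     (\<exists>zs. length zs = w \<and> set zs \<subseteq> tuples N s \<and>
        (\<forall>I\<subseteq>{..<w}. card I = k \<longrightarrow> solutions N r \<phi> ((!) zs ` I) = {}) \<and>
        (\<forall>z\<in>set zs. has_tree N r s \<phi> w ks (z # ys)))"

text \<open>The free variables are the \<open>l\<close> path labels, nearest node first; the
  quantified block of \<open>w * s\<close> variables holds the children. Sets of siblings appear as
  sublists of \<open>[0..<w]\<close>, and the renaming puts child \<open>j\<close> in front of the
  path, as in \<open>z # ys\<close>, and skips its siblings.\<close>

fun tree_fm :: "nat \<Rightarrow> nat \<Rightarrow> ('f, 'r) fm \<Rightarrow> nat \<Rightarrow> nat list \<Rightarrow> nat \<Rightarrow> ('f, 'r) fm" where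
  "tree_fm r s \<phi> w [] l = exn r (sol_fm r s \<phi> [0..<l])"
| "tree_fm r s \<phi> w (k # ks) l = exn (w * s) (FConj
     (conjs (map (\<lambda>J. FNeg (exn r (sol_fm r s \<phi> J))) (filter (\<lambda>J. length J = k) (subseqs [0..<w]))))
     (conjs (map (\<lambda>j. ren (\<lambda>v. if v < s then v + j * s else v - s + w * s)
        (tree_fm r s \<phi> w ks (Suc l))) [0..<w])))"

lemma set_subseqs_upt: "J \<in> set (subseqs [0..<w]) \<Longrightarrow> set J \<subseteq> {..<w} \<and> length J = card (set J)"
  using subseqs_powset[of "[0..<w]"] subseqs_distinctD[of J "[0..<w]"]
  by (auto simp: distinct_card lessThan_atLeast0)

lemma is_fmla_tree_fm:
  assumes "is_fmla L (r + s) \<phi>"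
  shows "is_fmla L (l * s) (tree_fm r s \<phi> w ks l)"
proof (induction ks arbitrary: l)
  case Nil
  then show ?case using is_fmla_sol_fm[OF assms, of "[0..<l]" l] by simp
next
  case (Cons k ks)
  have "is_fmla L (r + (w + l) * s) (sol_fm r s \<phi> J)" if "J \<in> set (subseqs [0..<w])" for J
    using is_fmla_sol_fm[OF assms, of J "w + l"] set_subseqs_upt[OF that] by force
  moreover have "is_fmla L (w * s + l * s) (ren (\<lambda>v. if v < s then v + j * s else v - s + w * s)
        (tree_fm r s \<phi> w ks (Suc l)))" if "j < w" for j
  proof (rule is_fmla_ren[OF Cons.IH])
    fix v assume v: "v < Suc l * s"
    have "Suc j * s \<le> w * s" using that by (intro mult_le_mono1) simp
    then show "(if v < s then v + j * s else v - s + w * s) < w * s + l * s"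
      using v by auto
  qed
  ultimately show ?case by (auto simp: algebra_simps)
qed

text \<open>Repeatedly cutting off the first \<open>s\<close> entries recovers the list of tuples;
  thus one block of quantifiers can choose all \<open>w\<close> children of a node.\<close>

lemma tuples_mult_eq_concat:
  "tuples N (w * s) = concat ` {zs. length zs = w \<and> set zs \<subseteq> tuples N s}"
proof (induction w)
  case 0
  then show ?case by (auto simp: tuples_def)
next
  case (Suc w)
  show ?case
  proof (intro equalityI subsetI; (elim imageE CollectE conjE)?)
    fix v assume v: "v \<in> tuples N (Suc w * s)"
    then have "drop s v \<in> tuples N (w * s)" by (auto simp: tuples_def dest: in_set_dropD)
    then obtain zs where "length zs = w" "set zs \<subseteq> tuples N s" "drop s v = concat zs"
      using Suc by auto
    moreover have "take s v \<in> tuples N s" using v by (auto simp: tuples_def dest: in_set_takeD)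
    ultimately show "v \<in> concat ` {zs. length zs = Suc w \<and> set zs \<subseteq> tuples N s}"
      by (intro image_eqI[of _ _ "take s v # zs"]) (auto, metis append_take_drop_id)
  next
    fix v zs assume zs: "v = concat zs" "length zs = Suc w" "set zs \<subseteq> tuples N s"
    then have "length (concat zs) = length zs * s"
      by (intro length_concat_uniform) (auto simp: tuples_def)
    then show "v \<in> tuples N (Suc w * s)"
      using zs by (auto simp: tuples_def)
  qed
qed

lemma all_subseqs_upt_iff:
  "(\<forall>J\<in>set (subseqs [0..<w]). length J = k \<longrightarrow> P (set J)) \<longleftrightarrow> (\<forall>I\<subseteq>{..<w}. card I = k \<longrightarrow> P I)"
proof safe
  fix I assume *: "\<forall>J\<in>set (subseqs [0..<w]). length J = card I \<longrightarrow> P (set J)" "I \<subseteq> {..<w}"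
  then have "I \<in> set ` set (subseqs [0..<w])" by (auto simp: subseqs_powset)
  then show "P I" using * set_subseqs_upt by auto
next
  fix J assume "\<forall>I\<subseteq>{..<w}. card I = length J \<longrightarrow> P I" "J \<in> set (subseqs [0..<w])" "k = length J"
  then show "P (set J)" using set_subseqs_upt[of J w] by simp
qed

text \<open>Height, width and degrees are fixed numbers, so having a tree is first-order in the path
  labels. This lets trees pass between \<open>M\<close>, the finite structures and other models of
  the theory, and between parameters of the same type.\<close>

lemma sat_tree_fm:
  assumes "is_fmla L (r + s) \<phi>" "univ N \<noteq> {}" "\<forall>y\<in>set ys. length y = s"
  shows "sat N (concat ys) (tree_fm r s \<phi> w ks (length ys)) \<longleftrightarrow> has_tree N r s \<phi> w ks ys"
  using assms(3)
proof (induction ks arbitrary: ys)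
  case Nil
  have "(!) ys ` {0..<length ys} = set ys" by (force simp: in_set_conv_nth)
  then show ?case using ex_solution_iff_sat[OF assms(1) _ Nil assms(2), of "[0..<length ys]"] by simp
next
  case (Cons k ks)
  have *: "sat N (concat zs @ concat ys) (FConj
     (conjs (map (\<lambda>J. FNeg (exn r (sol_fm r s \<phi> J))) (filter (\<lambda>J. length J = k) (subseqs [0..<w]))))
     (conjs (map (\<lambda>j. ren (\<lambda>v. if v < s then v + j * s else v - s + w * s)
        (tree_fm r s \<phi> w ks (Suc (length ys)))) [0..<w]))) \<longleftrightarrow>
      (\<forall>I\<subseteq>{..<w}. card I = k \<longrightarrow> solutions N r \<phi> ((!) zs ` I) = {}) \<and>
        (\<forall>z\<in>set zs. has_tree N r s \<phi> w ks (z # ys))" (is "sat N _ (FConj ?A ?B) \<longleftrightarrow> _")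
    if zs: "length zs = w" "set zs \<subseteq> tuples N s" for zs
  proof -
    have len: "\<forall>y\<in>set (zs @ ys). length y = s" using zs Cons.prems by (auto simp: tuples_def)
    have lz: "length (concat zs) = w * s"
      using length_concat_uniform[of zs s] len zs by simp
    have 1: "sat N (concat zs @ concat ys) (exn r (sol_fm r s \<phi> J)) \<longleftrightarrow>
        solutions N r \<phi> ((!) zs ` set J) \<noteq> {}" if "J \<in> set (subseqs [0..<w])" for J
    proof -
      \<comment> \<open>Sibling indices are below \<open>w\<close>, so no path label is
        picked.\<close>
      have "(!) (zs @ ys) ` set J = (!) zs ` set J"
        using set_subseqs_upt[OF that] zs by (intro image_cong) (auto simp: nth_append)
      then show ?thesis
        using ex_solution_iff_sat[OF assms(1) _ len assms(2), of J] set_subseqs_upt[OF that] zs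
        by fastforce
    qed
    have A: "sat N (concat zs @ concat ys) ?A \<longleftrightarrow>
        (\<forall>J\<in>set (subseqs [0..<w]). length J = k \<longrightarrow> solutions N r \<phi> ((!) zs ` set J) = {})"
      using 1 by (auto simp: sat_conjs[OF assms(2)])
    have "sat N (concat zs @ concat ys) (ren (\<lambda>v. if v < s then v + j * s else v - s + w * s)
        (tree_fm r s \<phi> w ks (Suc (length ys)))) \<longleftrightarrow> has_tree N r s \<phi> w ks (zs ! j # ys)"
      if j: "j < w" for j
    proof -
      have zj: "length (zs ! j) = s" using len zs j by simp
      have "sat N (concat zs @ concat ys) (ren (\<lambda>v. if v < s then v + j * s else v - s + w * s)
          (tree_fm r s \<phi> w ks (Suc (length ys)))) \<longleftrightarrow>
        sat N (concat (zs ! j # ys)) (tree_fm r s \<phi> w ks (Suc (length ys)))"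
      proof (rule sat_ren[OF is_fmla_tree_fm[OF assms(1)]])
        fix i assume "i < Suc (length ys) * s"
        have "j * s + i < w * s" if "i < s"
        proof -
          have "Suc j * s \<le> w * s" using j by (intro mult_le_mono1) simp
          then show ?thesis using that by simp
        qed
        then show "(concat zs @ concat ys) ! (if i < s then i + j * s else i - s + w * s) =
            concat (zs ! j # ys) ! i"
          using zj lz j zs len nth_concat_uniform[of zs s j i]
          by (auto simp: nth_append add.commute)
      qed
      also have "\<dots> \<longleftrightarrow> has_tree N r s \<phi> w ks (zs ! j # ys)"
        using Cons.IH[of "zs ! j # ys"] zj Cons.prems by simp
      finally show ?thesis .
    qed
    then have B: "sat N (concat zs @ concat ys) ?B \<longleftrightarrow> (\<forall>z\<in>set zs. has_tree N r s \<phi> w ks (z # ys))"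
      using zs(1) by (auto simp: sat_conjs[OF assms(2)] all_set_conv_all_nth)
    show ?thesis unfolding sat.simps A B
      using all_subseqs_upt_iff[of w k "\<lambda>I. solutions N r \<phi> ((!) zs ` I) = {}"] by simp
  qed
  have "sat N (concat ys) (tree_fm r s \<phi> w (k # ks) (length ys)) \<longleftrightarrow>
     (\<exists>zs. length zs = w \<and> set zs \<subseteq> tuples N s \<and> sat N (concat zs @ concat ys) (FConj
     (conjs (map (\<lambda>J. FNeg (exn r (sol_fm r s \<phi> J))) (filter (\<lambda>J. length J = k) (subseqs [0..<w]))))
     (conjs (map (\<lambda>j. ren (\<lambda>v. if v < s then v + j * s else v - s + w * s)
        (tree_fm r s \<phi> w ks (Suc (length ys)))) [0..<w]))))"
    by (auto simp: sat_exn tuples_mult_eq_concat simp del: sat.simps)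
  then show ?case using * by (simp del: sat.simps cong: conj_cong)
qed

section \<open>Shrinking branches in finite structures\<close>

lemma has_tree_imp_solutions:
  "has_tree N r s \<phi> w ks ys \<Longrightarrow> 0 < w \<Longrightarrow> solutions N r \<phi> (set ys) \<noteq> {}"
proof (induction ks arbitrary: ys)
  case (Cons k ks)
  \<comment> \<open>A child exists because \<open>0 < w\<close>, and a solution for the longer path
    solves the shorter one.\<close>
  then obtain z where "has_tree N r s \<phi> w ks (z # ys)"
    by (metis has_tree.simps(2) length_greater_0_conv list.set_intros(1) neq_Nil_conv)
  then have "solutions N r \<phi> (set (z # ys)) \<noteq> {}" using Cons by blast
  then show ?case by (auto simp: solutions_def)
qed simp

text \<open>The pairs \<open>(x, j)\<close> with \<open>x \<in> A j\<close> are counted in two ways.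
  If every \<open>A j\<close> were large, \<open>m\<close> times their number would be at least
  \<open>w * card X\<close>; it is at most \<open>m * k * card X\<close>, since no point lies in
  more than \<open>k\<close> of the sets. This contradicts \<open>m * k < w\<close>.\<close>

lemma exists_small_member:
  fixes A :: "nat \<Rightarrow> 'b set"
  assumes "finite X" "X \<noteq> {}" "\<And>j. j < w \<Longrightarrow> A j \<subseteq> X" "m * k < w"
    and "\<And>I. I \<subseteq> {..<w} \<Longrightarrow> card I = k \<Longrightarrow> X \<inter> (\<Inter>j\<in>I. A j) = {}"
  shows "\<exists>j<w. m * card (A j) < card X"
proof (rule ccontr)
  assume "\<not> ?thesis"
  then have large: "card X \<le> m * card (A j)" if "j < w" for j using that by force
  \<comment> \<open>Otherwise some \<open>k\<close> of the sets would have a common point in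
    \<open>X\<close>.\<close>
  have few: "card {j\<in>{..<w}. x \<in> A j} \<le> k" if "x \<in> X" for x
  proof (rule ccontr)
    assume "\<not> ?thesis"
    then obtain I where "I \<subseteq> {j\<in>{..<w}. x \<in> A j}" "card I = k"
      using obtain_subset_with_card_n[of k "{j\<in>{..<w}. x \<in> A j}"] by auto
    then show False using assms(5)[of I] that by auto
  qed
  have "w * card X = (\<Sum>j<w. card X)" by simp
  also have "\<dots> \<le> (\<Sum>j<w. m * card (A j))" using large by (intro sum_mono) auto
  also have "\<dots> = m * (\<Sum>j<w. card {x\<in>X. x \<in> A j})"
    unfolding sum_distrib_left using assms(3)
    by (intro sum.cong refl arg_cong[where f = "\<lambda>S. m * card S"]) auto
  also have "(\<Sum>j<w. card {x\<in>X. x \<in> A j}) = (\<Sum>x\<in>X. card {j\<in>{..<w}. x \<in> A j})"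
    using assms(1) by (intro sum_multicount_gen) auto
  also have "m * \<dots> \<le> m * (\<Sum>x\<in>X. k)" using few by (intro mult_le_mono2 sum_mono) auto
  finally have "w * card X \<le> (m * k) * card X" by (simp add: algebra_simps)
  then show False using assms(1,2,4) by (simp add: card_gt_0_iff)
qed

text \<open>The branch is built greedily downwards: at each node the solution set of the path so far
  plays the role of \<open>X\<close> in \<open>exists_small_member\<close>, and its subsets cut out
  by the children's instances that of the \<open>A j\<close>. The inconsistency of siblings is the
  hypothesis on intersections.\<close>

lemma has_tree_imp_shrinking_branch:
  assumes "finite (univ N)" "0 < w" "\<forall>k\<in>set ks. m * k < w" "has_tree N r s \<phi> w ks ys"
  shows "\<exists>zs. length zs = length ks \<and> set zs \<subseteq> tuples N s \<and>
    solutions N r \<phi> (set zs \<union> set ys) \<noteq> {} \<and>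
    (\<forall>j<length ks. m * card (solutions N r \<phi> (set (take (Suc j) zs) \<union> set ys))
       < card (solutions N r \<phi> (set (take j zs) \<union> set ys)))"
  using assms(3,4)
proof (induction ks arbitrary: ys)
  case (Cons k ks)
  have fin: "finite (solutions N r \<phi> (set ys))"
  proof (rule finite_subset)
    show "finite {v. set v \<subseteq> univ N \<and> length v = r}" using assms(1) by (rule finite_lists_length_eq)
  qed (auto simp: solutions_def tuples_def)
  obtain zs where zs: "length zs = w" "set zs \<subseteq> tuples N s"
    "\<And>I. I\<subseteq>{..<w} \<Longrightarrow> card I = k \<Longrightarrow> solutions N r \<phi> ((!) zs ` I) = {}"
    "\<And>z. z\<in>set zs \<Longrightarrow> has_tree N r s \<phi> w ks (z # ys)"
    using Cons.prems(2) by auto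
  have "\<exists>j<w. m * card (solutions N r \<phi> (set (zs ! j # ys))) < card (solutions N r \<phi> (set ys))"
  proof (rule exists_small_member[OF fin])
    show "solutions N r \<phi> (set ys) \<noteq> {}"
      using has_tree_imp_solutions[OF Cons.prems(2) assms(2)] .
    show "m * k < w" using Cons.prems by simp
    fix I assume "I \<subseteq> {..<w}" "card I = k"
    then have "solutions N r \<phi> ((!) zs ` I) = {}" by (rule zs)
    then show "solutions N r \<phi> (set ys) \<inter> (\<Inter>j\<in>I. solutions N r \<phi> (set (zs ! j # ys))) = {}"
      by (fastforce simp: solutions_def)
  qed (auto simp: solutions_def)
  then obtain j where j: "j < w"
    "m * card (solutions N r \<phi> (set (zs ! j # ys))) < card (solutions N r \<phi> (set ys))" by blast
  let ?z = "zs ! j"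
  have z: "?z \<in> set zs" using j zs by simp
  obtain us where us: "length us = length ks" "set us \<subseteq> tuples N s"
    "solutions N r \<phi> (set us \<union> set (?z # ys)) \<noteq> {}"
    "\<And>j. j<length ks \<Longrightarrow> m * card (solutions N r \<phi> (set (take (Suc j) us) \<union> set (?z # ys)))
       < card (solutions N r \<phi> (set (take j us) \<union> set (?z # ys)))"
    using Cons.IH[OF _ zs(4)[OF z]] Cons.prems by auto
  show ?case
  proof (intro exI[of _ "?z # us"] conjI allI impI)
    show "set (?z # us) \<subseteq> tuples N s" using us z zs by auto
    \<comment> \<open>Step 0 is the choice of \<open>?z\<close>; step \<open>i > 0\<close> is step
      \<open>i - 1\<close> of the branch below it.\<close>
    fix i assume "i < length (k # ks)"
    then show "m * card (solutions N r \<phi> (set (take (Suc i) (?z # us)) \<union> set ys))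
        < card (solutions N r \<phi> (set (take i (?z # us)) \<union> set ys))"
      using j(2) us(4)[of "i - 1"] by (cases i) auto
  qed (use us in auto)
qed (auto simp: solutions_def)

section \<open>Sources of trees\<close>

lemma consistent_finite: "finite B \<Longrightarrow> consistent N r \<phi> B \<longleftrightarrow> solutions N r \<phi> B \<noteq> {}"
  by (auto simp: consistent_def solutions_def)

text \<open>Only the first \<open>w\<close> successors of each node are kept. The induction runs
  over path labels taken from initial segments of one node \<sigma>, as these lie on a common branch
  and hence are consistent.\<close>

lemma tree_property_imp_has_tree:
  assumes tp: "\<And>\<sigma>. a \<sigma> \<in> tuples N s"
    "\<And>\<eta> :: nat \<Rightarrow> nat. consistent N r \<phi> {a (map \<eta> [0..<n]) | n. True}"
    "\<And>\<sigma>. k_inconsistent N r \<phi> k (\<lambda>i. a (\<sigma> @ [i]))"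
  shows "set ys \<subseteq> {a (take j \<sigma>) | j. j \<le> length \<sigma>} \<Longrightarrow> has_tree N r s \<phi> w (replicate n k) ys"
proof (induction n arbitrary: \<sigma> ys)
  case 0
  \<comment> \<open>Any branch through \<sigma> serves; here \<sigma> is continued by zeros.\<close>
  define \<eta> where "\<eta> i = (if i < length \<sigma> then \<sigma> ! i else 0)" for i
  have "take j \<sigma> = map \<eta> [0..<j]" if "j \<le> length \<sigma>" for j
    using that by (intro nth_equalityI) (auto simp: \<eta>_def)
  then have "set ys \<subseteq> {a (map \<eta> [0..<n]) | n. True}" using 0 by fastforce
  then show ?case using tp(2)[of \<eta>] by (simp add: consistent_def)
next
  case (Suc n)
  let ?zs = "map (\<lambda>i. a (\<sigma> @ [i])) [0..<w]"
  have "has_tree N r s \<phi> w (replicate n k) (a (\<sigma> @ [i]) # ys)" for i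
  proof (rule Suc.IH[of _ "\<sigma> @ [i]"])
    have "a (take j \<sigma>) \<in> {a (take j (\<sigma> @ [i])) |j. j \<le> length (\<sigma> @ [i])}" if "j \<le> length \<sigma>" for j
      using that by (auto intro!: exI[of _ j])
    moreover have "a (\<sigma> @ [i]) \<in> {a (take j (\<sigma> @ [i])) |j. j \<le> length (\<sigma> @ [i])}"
      by (auto intro!: exI[of _ "Suc (length \<sigma>)"])
    ultimately show "set (a (\<sigma> @ [i]) # ys) \<subseteq> {a (take j (\<sigma> @ [i])) |j. j \<le> length (\<sigma> @ [i])}"
      using Suc.prems by fastforce
  qed
  moreover have "solutions N r \<phi> ((!) ?zs ` I) = {}" if "I \<subseteq> {..<w}" "card I = k" for I
  proof -
    have eq: "(!) ?zs ` I = (\<lambda>i. a (\<sigma> @ [i])) ` I" using that by (intro image_cong) auto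
    have I: "finite I" using that by (auto intro: finite_subset)
    then have "\<not> consistent N r \<phi> ((\<lambda>i. a (\<sigma> @ [i])) ` I)"
      using tp(3)[of \<sigma>] that by (auto simp: k_inconsistent_def)
    then show ?thesis unfolding eq using I by (simp add: consistent_finite)
  qed
  ultimately show ?case using tp(1) by (auto intro!: exI[of _ ?zs])
qed

text \<open>A tree above \<open>a 0, ..., a i\<close> is described by a formula in these parameters,
  so it survives replacing \<open>a i\<close> by any tuple of the same type over the earlier
  entries. The first \<open>w\<close> terms of a sequence witnessing dividing thus become the
  children at height \<open>i\<close>. The degrees come from the chain alone, so the same
  \<open>ks\<close> serves every \<open>w\<close>.\<close>

lemma dividing_chain_imp_has_tree:
  assumes \<phi>: "is_fmla L (r + s) \<phi>" and N: "univ N \<noteq> {}" and chain: "dividing_chain L N r s \<phi> n a"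
  shows "\<exists>ks. length ks = n \<and> (\<forall>w. has_tree N r s \<phi> w ks [])"
proof -
  have "\<forall>i<n. \<exists>k b. (\<forall>j. b j \<in> tuples N s \<and> same_type L N (\<Union>j<i. set (a j)) (a i) (b j)) \<and>
      k_inconsistent N r \<phi> k b"
    using chain by (auto simp: dividing_chain_def divides_over_def)
  then obtain k b where kb: "\<And>i j. i < n \<Longrightarrow> b i j \<in> tuples N s"
    "\<And>i j. i < n \<Longrightarrow> same_type L N (\<Union>j<i. set (a j)) (a i) (b i j)"
    "\<And>i. i < n \<Longrightarrow> k_inconsistent N r \<phi> (k i) (b i)" by metis
  have a: "length (a i) = s" if "i < n" for i
    using chain that by (auto simp: dividing_chain_def tuples_def)
  have "has_tree N r s \<phi> w (map k [i..<n]) (rev (map a [0..<i]))" if "i \<le> n" for w i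
    using that
  proof (induction rule: inc_induct)
    case base
    then show ?case using chain
      by (auto simp: dividing_chain_def consistent_def lessThan_atLeast0)
  next
    case (step i)
    let ?ys = "rev (map a [0..<i])" and ?zs = "map (b i) [0..<w]"
    have ys: "\<forall>y\<in>set ?ys. length y = s" using a step.hyps by auto
    have "has_tree N r s \<phi> w (map k [Suc i..<n]) (b i j # ?ys)" for j
    proof -
      let ?f = "tree_fm r s \<phi> w (map k [Suc i..<n]) (Suc i)"
      have "sat N (a i @ concat ?ys) ?f"
        using sat_tree_fm[OF \<phi> N, of "a i # ?ys" w "map k [Suc i..<n]"] ys a step by auto
      moreover have "is_fmla L (length (a i) + length (concat ?ys)) ?f"
        using is_fmla_tree_fm[OF \<phi>, of "Suc i" w] length_concat_uniform[OF ys] a step.hyps by simp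
      ultimately have "sat N (b i j @ concat ?ys) ?f"
        using kb(2)[OF step.hyps(2), of j] unfolding same_type_def
        by (elim conjE allE[of _ ?f] allE[of _ "concat ?ys"] impE) (auto simp: lessThan_atLeast0)
      then show ?thesis
        using sat_tree_fm[OF \<phi> N, of "b i j # ?ys" w "map k [Suc i..<n]"] ys kb(1)[of i j] step.hyps
        by (auto simp: tuples_def)
    qed
    moreover have "solutions N r \<phi> ((!) ?zs ` I) = {}" if "I \<subseteq> {..<w}" "card I = k i" for I
    proof -
      have eq: "(!) ?zs ` I = b i ` I" using that by (intro image_cong) auto
      have I: "finite I" using that by (auto intro: finite_subset)
      then have "\<not> consistent N r \<phi> (b i ` I)"
        using kb(3)[of i] step.hyps that by (auto simp: k_inconsistent_def)
      then show ?thesis unfolding eq using I by (simp add: consistent_finite)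
    qed
    ultimately have "has_tree N r s \<phi> w (k i # map k [Suc i..<n]) ?ys"
      using kb(1) step.hyps by (auto intro!: exI[of _ ?zs])
    then show ?case using step.hyps by (simp add: upt_conv_Cons)
  qed
  from this[of 0] show ?thesis by (intro exI[of _ "map k [0..<n]"]) simp
qed

section \<open>Ultraproducts and dimensions\<close>

lemma ev_urep_ucls: "eventually (\<lambda>i. urep (ucls U g) i = g i) U"
proof -
  have "g \<in> ucls U g" by (simp add: ucls_def)
  then have "urep (ucls U g) \<in> ucls U g" unfolding urep_def by (rule someI[of "\<lambda>h. h \<in> ucls U g"])
  then show ?thesis by (simp add: ucls_def)
qed

lemma ucls_eq_iff: "ucls U g = ucls U h \<longleftrightarrow> eventually (\<lambda>i. g i = h i) U"
proof
  assume "ucls U g = ucls U h"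
  moreover have "g \<in> ucls U g" by (simp add: ucls_def)
  ultimately show "eventually (\<lambda>i. g i = h i) U" by (simp add: ucls_def)
next
  assume gh: "eventually (\<lambda>i. g i = h i) U"
  have "eventually (\<lambda>i. k i = g i) U \<longleftrightarrow> eventually (\<lambda>i. k i = h i) U" for k
  proof
    assume "eventually (\<lambda>i. k i = g i) U"
    with gh show "eventually (\<lambda>i. k i = h i) U" by eventually_elim simp
  next
    assume "eventually (\<lambda>i. k i = h i) U"
    with gh show "eventually (\<lambda>i. k i = g i) U" by eventually_elim simp
  qed
  then show "ucls U g = ucls U h" by (simp add: ucls_def)
qed

lemma ucls_urep:
  assumes "q \<in> range (ucls U)"
  shows "ucls U (urep q) = q"
proof -
  obtain g where "q = ucls U g" using assms by blast
  then show ?thesis by (simp only: ucls_eq_iff ev_urep_ucls)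
qed

lemma range_ucls_eq_iff:
  "q \<in> range (ucls U) \<Longrightarrow> q' \<in> range (ucls U) \<Longrightarrow>
    q = q' \<longleftrightarrow> eventually (\<lambda>i. urep q i = urep q' i) U"
  using ucls_eq_iff[of U "urep q" "urep q'"] by (simp add: ucls_urep)

lemma univ_ultraproduct_iff:
  "q \<in> univ (ultraproduct U) \<longleftrightarrow> q \<in> range (ucls U) \<and> eventually (\<lambda>N. urep q N \<in> univ N) U"
proof -
  have "eventually (\<lambda>N. urep (ucls U g) N \<in> univ N) U \<longleftrightarrow> eventually (\<lambda>N. g N \<in> univ N) U" for g
    by (rule eventually_cong) (use ev_urep_ucls[of U g] in \<open>auto elim: eventually_mono\<close>)
  then show ?thesis by (auto simp: ultraproduct_def)
qed

text \<open>The term part of Los's theorem: finitely many subterms agree with their coordinatewise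
  values on a common large set of structures.\<close>

lemma tm_val_ultraproduct:
  assumes "set e \<subseteq> univ (ultraproduct U)" "is_tm L (length e) t"
  shows "tm_val (ultraproduct U) e t \<in> range (ucls U) \<and>
    eventually (\<lambda>N. urep (tm_val (ultraproduct U) e t) N = tm_val N (map (\<lambda>q. urep q N) e) t) U"
  using assms(2)
proof (induction t)
  case (Var i)
  then have "e ! i \<in> univ (ultraproduct U)" using assms(1) by auto
  then show ?case using Var by (simp add: univ_ultraproduct_iff)
next
  case (App f ts)
  let ?M = "ultraproduct U"
  let ?g = "\<lambda>N. fun_int N f (map (\<lambda>q. urep q N) (map (tm_val ?M e) ts))"
  have val: "tm_val ?M e (App f ts) = ucls U ?g" by (simp add: ultraproduct_def)
  have "eventually (\<lambda>N. \<forall>t\<in>set ts.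
      urep (tm_val ?M e t) N = tm_val N (map (\<lambda>q. urep q N) e) t) U"
    using App by (intro eventually_ball_finite) auto
  with ev_urep_ucls[of U ?g]
  have "eventually (\<lambda>N. urep (ucls U ?g) N = tm_val N (map (\<lambda>q. urep q N) e) (App f ts)) U"
  proof eventually_elim
    case (elim N)
    then have "map (\<lambda>q. urep q N) (map (tm_val ?M e) ts) = map (tm_val N (map (\<lambda>q. urep q N) e)) ts"
      by simp
    then show ?case using elim(1) by (simp del: map_map map_eq_conv)
  qed
  then show ?case unfolding val by auto
qed

text \<open>Integer bounds on both sides amount to one real bound on the absolute value, and
  representatives agree with the given sequences almost everywhere. So a coset of
  \<open>hull_int U\<close> consists of the classes of sequences whose distance from
  \<open>g\<close> is bounded almost everywhere.\<close>

lemma coset_eq: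
  "coset U (ucls U g) = {ucls U h | h. \<exists>c::real. eventually (\<lambda>i. \<bar>h i - g i\<bar> \<le> c) U}"
proof -
  have "ucls U h \<in> coset U (ucls U g) \<longleftrightarrow> (\<exists>c. eventually (\<lambda>i. \<bar>h i - g i\<bar> \<le> c) U)" for h
  proof -
    let ?d = "hminus U (ucls U h) (ucls U g)"
    have d: "eventually (\<lambda>i. urep ?d i = h i - g i) U"
      using ev_urep_ucls[of U "\<lambda>i. urep (ucls U h) i - urep (ucls U g) i"]
        ev_urep_ucls[of U h] ev_urep_ucls[of U g]
      unfolding hminus_def by eventually_elim simp
    have "hle U (hconst U c) ?d \<longleftrightarrow> eventually (\<lambda>i. c \<le> h i - g i) U"
      "hle U ?d (hconst U c) \<longleftrightarrow> eventually (\<lambda>i. h i - g i \<le> c) U" for c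
    proof -
      have "eventually (\<lambda>i. urep (hconst U c) i = c) U" unfolding hconst_def by (rule ev_urep_ucls)
      with d have *: "eventually (\<lambda>i. urep ?d i = h i - g i \<and> urep (hconst U c) i = c) U"
        by (rule eventually_conj)
      show "hle U (hconst U c) ?d \<longleftrightarrow> eventually (\<lambda>i. c \<le> h i - g i) U"
        unfolding hle_def by (rule eventually_cong[OF *]) auto
      show "hle U ?d (hconst U c) \<longleftrightarrow> eventually (\<lambda>i. h i - g i \<le> c) U"
        unfolding hle_def by (rule eventually_cong[OF *]) auto
    qed
    moreover have "(\<exists>m n::int. eventually (\<lambda>i. of_int m \<le> h i - g i) U \<and>
        eventually (\<lambda>i. h i - g i \<le> of_int n) U) \<longleftrightarrow> (\<exists>c. eventually (\<lambda>i. \<bar>h i - g i\<bar> \<le> c) U)"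
    proof safe
      fix m n :: int
      assume "eventually (\<lambda>i. of_int m \<le> h i - g i) U" "eventually (\<lambda>i. h i - g i \<le> of_int n) U"
      then have "eventually (\<lambda>i. \<bar>h i - g i\<bar> \<le> \<bar>of_int m\<bar> + \<bar>of_int n\<bar>) U"
        by eventually_elim linarith
      then show "\<exists>c. eventually (\<lambda>i. \<bar>h i - g i\<bar> \<le> c) U" by blast
    next
      fix c assume c: "eventually (\<lambda>i. \<bar>h i - g i\<bar> \<le> c) U"
      from c have "eventually (\<lambda>i. of_int (- \<lceil>c\<rceil>) \<le> h i - g i) U"
        by eventually_elim linarith
      moreover from c have "eventually (\<lambda>i. h i - g i \<le> of_int \<lceil>c\<rceil>) U"
        by eventually_elim linarith
      ultimately show "\<exists>m n::int. eventually (\<lambda>i. of_int m \<le> h i - g i) U \<and>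
        eventually (\<lambda>i. h i - g i \<le> of_int n) U" by blast
    qed
    moreover have "?d \<in> hyperreals U" "ucls U h \<in> hyperreals U"
      by (auto simp: hyperreals_def hminus_def)
    ultimately show ?thesis unfolding coset_def hull_int_def mem_Collect_eq by blast
  qed
  note mem = this
  show ?thesis
  proof (intro equalityI subsetI)
    fix x assume x: "x \<in> coset U (ucls U g)"
    then obtain h where "x = ucls U h" by (auto simp: coset_def hyperreals_def)
    then show "x \<in> {ucls U h | h. \<exists>c::real. eventually (\<lambda>i. \<bar>h i - g i\<bar> \<le> c) U}"
      using x mem[of h] by simp blast
  qed (use mem in force)
qed

text \<open>Moving within a coset costs a bounded error, which gives one direction; shifting
  \<open>h\<close> by the constant stays in its coset and gives the other.\<close>

lemma coset_le_iff:
  "coset_le U (coset U (ucls U g)) (coset U (ucls U h)) \<longleftrightarrow>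
    (\<exists>c::real. eventually (\<lambda>i. g i \<le> h i + c) U)"
proof
  assume "coset_le U (coset U (ucls U g)) (coset U (ucls U h))"
  then obtain g' h' b c where *: "eventually (\<lambda>i. \<bar>g' i - g i\<bar> \<le> b) U"
    "eventually (\<lambda>i. \<bar>h' i - h i\<bar> \<le> c) U" "hle U (ucls U g') (ucls U h')"
    by (auto simp: coset_le_def coset_eq)
  from *(1,2) *(3)[unfolded hle_def] ev_urep_ucls[of U g'] ev_urep_ucls[of U h']
  have "eventually (\<lambda>i. g i \<le> h i + (b + c)) U" by eventually_elim linarith
  then show "\<exists>c. eventually (\<lambda>i. g i \<le> h i + c) U" by blast
next
  assume "\<exists>c. eventually (\<lambda>i. g i \<le> h i + c) U"
  then obtain c where c: "eventually (\<lambda>i. g i \<le> h i + c) U" by blast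
  have "ucls U g \<in> coset U (ucls U g)" by (auto simp: coset_eq intro!: exI[of _ g] exI[of _ 0])
  moreover have "ucls U (\<lambda>i. h i + c) \<in> coset U (ucls U h)"
    by (auto simp: coset_eq intro!: exI[of _ "\<lambda>i. h i + c"] exI[of _ "\<bar>c\<bar>"])
  moreover have "hle U (ucls U g) (ucls U (\<lambda>i. h i + c))"
    using c ev_urep_ucls[of U g] ev_urep_ucls[of U "\<lambda>i. h i + c"]
    unfolding hle_def by eventually_elim linarith
  ultimately show "coset_le U (coset U (ucls U g)) (coset U (ucls U h))"
    by (auto simp: coset_le_def)
qed

lemma coset_cong:
  assumes "eventually (\<lambda>i. \<bar>g i - h i\<bar> \<le> (b::real)) U"
  shows "coset U (ucls U g) = coset U (ucls U h)"
proof -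
  have "(\<exists>c. eventually (\<lambda>i. \<bar>k i - g i\<bar> \<le> c) U) \<longleftrightarrow> (\<exists>c. eventually (\<lambda>i. \<bar>k i - h i\<bar> \<le> c) U)" for k
  proof safe
    fix c assume "eventually (\<lambda>i. \<bar>k i - g i\<bar> \<le> c) U"
    with assms have "eventually (\<lambda>i. \<bar>k i - h i\<bar> \<le> c + b) U" by eventually_elim linarith
    then show "\<exists>c. eventually (\<lambda>i. \<bar>k i - h i\<bar> \<le> c) U" by blast
  next
    fix c assume "eventually (\<lambda>i. \<bar>k i - h i\<bar> \<le> c) U"
    with assms have "eventually (\<lambda>i. \<bar>k i - g i\<bar> \<le> c + b) U" by eventually_elim linarith
    then show "\<exists>c. eventually (\<lambda>i. \<bar>k i - g i\<bar> \<le> c) U" by blast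
  qed
  then show ?thesis by (simp add: coset_eq)
qed

section \<open>Dimensions of arbitrary sequences of reals\<close>

definition dim_of :: "'i filter \<Rightarrow> ('i \<Rightarrow> real) \<Rightarrow> 'i dim" where
  "dim_of U g = (if eventually (\<lambda>i. g i = 0) U then None
     else Some (coset U (ucls U (\<lambda>i. ln (g i)))))"

definition count :: "nat \<Rightarrow> ('f, 'r) fm \<Rightarrow> (('f, 'r, 'a) struct \<Rightarrow> 'a) set list \<Rightarrow>
    ('f, 'r, 'a) struct \<Rightarrow> real" where
  "count r \<phi> a N = real (card (def_set N r \<phi> (map (\<lambda>q. urep q N) a)))"

lemma delta_eq_dim_of: "delta U r \<phi> a = dim_of U (count r \<phi> a)"
proof -
  have f: "f_count U r \<phi> a = ucls U (count r \<phi> a)" by (simp add: f_count_def count_def[abs_def])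
  have "hlog U (ucls U (count r \<phi> a)) = ucls U (\<lambda>N. ln (count r \<phi> a N))"
    unfolding hlog_def ucls_eq_iff using ev_urep_ucls[of U "count r \<phi> a"]
    by eventually_elim simp
  then show ?thesis by (simp add: delta_def f dim_of_def hconst_def ucls_eq_iff)
qed

lemma dim_of_Some_in_cosets: "dim_of U g = Some q \<Longrightarrow> q \<in> cosets U"
  by (auto simp: dim_of_def cosets_def hyperreals_def split: if_splits)

locale ultrafilter =
  fixes U :: "'i filter"
  assumes not_bot: "U \<noteq> bot"
    and ultra: "\<And>P. eventually P U \<or> eventually (\<lambda>i. \<not> P i) U"
begin

lemma ev_not_iff: "eventually (\<lambda>i. \<not> P i) U \<longleftrightarrow> \<not> eventually P U"
proof
  assume P: "eventually (\<lambda>i. \<not> P i) U"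
  show "\<not> eventually P U"
  proof
    assume "eventually P U"
    with P have "eventually (\<lambda>i. False) U" by eventually_elim simp
    then show False using not_bot by simp
  qed
qed (use ultra in blast)

text \<open>Exponentiation turns a bounded error between logarithms into a bounded ratio. Hence
  dimensions compare like cardinalities up to a standard factor. The value \<open>None\<close> fits
  the same criterion: a nonnegative sequence bounded by a multiple of 0 is 0.\<close>

lemma dim_le_dim_of_iff:
  assumes "\<And>i. 0 \<le> g i" "\<And>i. 0 \<le> h i"
  shows "dim_le U (dim_of U g) (dim_of U h) \<longleftrightarrow> (\<exists>c. eventually (\<lambda>i. g i \<le> c * h i) U)"
proof (cases "eventually (\<lambda>i. g i = 0) U")
  case True
  then have "eventually (\<lambda>i. g i \<le> 0 * h i) U" by eventually_elim simp
  moreover have "dim_of U g = None" using True by (simp add: dim_of_def)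
  ultimately show ?thesis using dim_le.simps(1) by metis
next
  case g: False
  show ?thesis
  proof (cases "eventually (\<lambda>i. h i = 0) U")
    case True
    have False if "eventually (\<lambda>i. g i \<le> c * h i) U" for c
    proof -
      from that True have "eventually (\<lambda>i. g i = 0) U"
        by eventually_elim (use assms in \<open>auto intro: antisym\<close>)
      then show False using g by simp
    qed
    then show ?thesis using g True by (auto simp: dim_of_def)
  next
    case h: False
    have pos: "eventually (\<lambda>i. 0 < g i) U" "eventually (\<lambda>i. 0 < h i) U"
      using g h assms unfolding ev_not_iff[symmetric]
      by (auto elim!: eventually_mono simp: less_le)
    have "(\<exists>c. eventually (\<lambda>i. ln (g i) \<le> ln (h i) + c) U) \<longleftrightarrow>
        (\<exists>c. eventually (\<lambda>i. g i \<le> c * h i) U)"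
    proof safe
      fix c assume "eventually (\<lambda>i. ln (g i) \<le> ln (h i) + c) U"
      with pos have "eventually (\<lambda>i. g i \<le> exp c * h i) U"
      proof eventually_elim
        case (elim i)
        then have "exp (ln (g i)) \<le> exp (ln (h i) + c)" by (simp only: exp_le_cancel_iff)
        then show ?case using elim by (simp add: exp_add mult.commute)
      qed
      then show "\<exists>c. eventually (\<lambda>i. g i \<le> c * h i) U" by blast
    next
      fix c assume "eventually (\<lambda>i. g i \<le> c * h i) U"
      with pos have "eventually (\<lambda>i. ln (g i) \<le> ln (h i) + ln c) U"
      proof eventually_elim
        case (elim i)
        then have "0 < c" by (metis less_le_trans zero_less_mult_pos2)
        moreover have "ln (g i) \<le> ln (c * h i)" using elim by (intro ln_mono) auto
        ultimately show ?case using elim by (simp add: ln_mult)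
      qed
      then show "\<exists>c. eventually (\<lambda>i. ln (g i) \<le> ln (h i) + c) U" by blast
    qed
    then show ?thesis using g h by (simp add: dim_of_def coset_le_iff)
  qed
qed

lemma dim_of_linear:
  assumes "\<And>i. 0 \<le> g i" "\<And>i. 0 \<le> h i"
  shows "dim_le U (dim_of U g) (dim_of U h) \<or> dim_le U (dim_of U h) (dim_of U g)"
proof -
  have "eventually (\<lambda>i. g i \<le> 1 * h i) U \<or> eventually (\<lambda>i. h i \<le> 1 * g i) U"
    using ultra[of "\<lambda>i. g i \<le> 1 * h i"]
      eventually_mono[of "\<lambda>i. \<not> g i \<le> 1 * h i" U "\<lambda>i. h i \<le> 1 * g i"] by fastforce
  then show ?thesis using assms by (simp only: dim_le_dim_of_iff) blast
qed

lemma dim_of_antisym: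
  assumes le: "dim_le U (dim_of U g) (dim_of U h)" "dim_le U (dim_of U h) (dim_of U g)"
  shows "dim_of U g = dim_of U h"
proof (cases "dim_of U g")
  case None
  then show ?thesis using le by (cases "dim_of U h") auto
next
  case (Some P)
  then obtain Q where Q: "dim_of U h = Some Q" using le by (cases "dim_of U h") auto
  have P': "P = coset U (ucls U (\<lambda>i. ln (g i)))" "Q = coset U (ucls U (\<lambda>i. ln (h i)))"
    using Some Q by (auto simp: dim_of_def split: if_splits)
  with le Some Q obtain b c where "eventually (\<lambda>i. ln (g i) \<le> ln (h i) + b) U"
    "eventually (\<lambda>i. ln (h i) \<le> ln (g i) + c) U"
    by (auto simp: coset_le_iff)
  then have "eventually (\<lambda>i. \<bar>ln (g i) - ln (h i)\<bar> \<le> \<bar>b\<bar> + \<bar>c\<bar>) U" by eventually_elim linarith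
  then have "P = Q" unfolding P' by (rule coset_cong)
  then show ?thesis using Some Q by simp
qed

lemma dim_of_trans:
  assumes "\<And>i. 0 \<le> f i" "\<And>i. 0 \<le> g i" "\<And>i. 0 \<le> h i"
    and "dim_le U (dim_of U f) (dim_of U g)" "dim_le U (dim_of U g) (dim_of U h)"
  shows "dim_le U (dim_of U f) (dim_of U h)"
proof -
  obtain b c where bc: "eventually (\<lambda>i. f i \<le> b * g i) U" "eventually (\<lambda>i. g i \<le> c * h i) U"
    using assms by (auto simp: dim_le_dim_of_iff)
  \<comment> \<open>\<open>b\<close> may be negative; \<bar>b\<bar> keeps the multiplication
    monotone.\<close>
  from bc have "eventually (\<lambda>i. f i \<le> (\<bar>b\<bar> * c) * h i) U"
  proof eventually_elim
    case (elim i)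
    have "b * g i \<le> \<bar>b\<bar> * g i" using assms(2)[of i] by (intro mult_right_mono) auto
    moreover have "\<bar>b\<bar> * g i \<le> \<bar>b\<bar> * (c * h i)" using elim by (intro mult_left_mono) auto
    ultimately show ?case using elim by (simp add: mult.assoc)
  qed
  then show ?thesis using assms by (auto simp: dim_le_dim_of_iff)
qed

end

section \<open>Los's theorem and the definable sets of \<open>M\<close>\<close>

locale pseudofinite = ultrafilter U for U :: "('f, 'r, 'a) struct filter" +
  assumes ev_finite: "eventually (\<lambda>N. finite (univ N)) U"
    and infinite_univ: "infinite (univ (ultraproduct U))"
begin

abbreviation "M \<equiv> ultraproduct U"

text \<open>Maximality of the ultrafilter settles negation; for a quantifier, witnesses chosen in
  almost all structures form one sequence whose class is a witness in \<open>M\<close>.\<close>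

lemma los:
  "set e \<subseteq> univ M \<Longrightarrow> is_fmla L (length e) \<phi> \<Longrightarrow>
    sat M e \<phi> \<longleftrightarrow> eventually (\<lambda>N. sat N (map (\<lambda>q. urep q N) e) \<phi>) U"
proof (induction \<phi> arbitrary: e)
  case (FEq t u)
  then have t: "tm_val M e t \<in> range (ucls U)"
      "eventually (\<lambda>N. urep (tm_val M e t) N = tm_val N (map (\<lambda>q. urep q N) e) t) U"
    and u: "tm_val M e u \<in> range (ucls U)"
      "eventually (\<lambda>N. urep (tm_val M e u) N = tm_val N (map (\<lambda>q. urep q N) e) u) U"
    using tm_val_ultraproduct[of e U L] by auto
  have "sat M e (FEq t u) \<longleftrightarrow> eventually (\<lambda>N. urep (tm_val M e t) N = urep (tm_val M e u) N) U"
    using range_ucls_eq_iff[OF t(1) u(1)] by simp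
  also have "\<dots> \<longleftrightarrow> eventually (\<lambda>N. sat N (map (\<lambda>q. urep q N) e) (FEq t u)) U"
    by (rule eventually_cong[OF eventually_conj[OF t(2) u(2)]]) auto
  finally show ?case .
next
  case (FRel R ts)
  have "eventually (\<lambda>N. \<forall>t\<in>set ts.
      urep (tm_val M e t) N = tm_val N (map (\<lambda>q. urep q N) e) t) U"
    using FRel tm_val_ultraproduct[of e U L] by (intro eventually_ball_finite) auto
  then have ts: "eventually (\<lambda>N. map (\<lambda>q. urep q N) (map (tm_val M e) ts) =
      map (tm_val N (map (\<lambda>q. urep q N) e)) ts) U"
    by eventually_elim simp
  have "sat M e (FRel R ts) \<longleftrightarrow>
      eventually (\<lambda>N. rel_int N R (map (\<lambda>q. urep q N) (map (tm_val M e) ts))) U"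
    by (simp add: ultraproduct_def)
  also have "\<dots> \<longleftrightarrow> eventually (\<lambda>N. sat N (map (\<lambda>q. urep q N) e) (FRel R ts)) U"
    by (rule eventually_cong[OF ts]) (simp del: map_map map_eq_conv)
  finally show ?case .
next
  case (FNeg \<phi>)
  then show ?case by (simp add: ev_not_iff)
next
  case (FConj \<phi> \<psi>)
  then show ?case by (simp add: eventually_conj_iff)
next
  case (FEx \<phi>)
  have IH: "sat M (a # e) \<phi> \<longleftrightarrow> eventually (\<lambda>N. sat N (urep a N # map (\<lambda>q. urep q N) e) \<phi>) U"
    if "a \<in> univ M" for a
    using FEx.IH[of "a # e"] FEx.prems that by simp
  show ?case
  proof
    assume "sat M e (FEx \<phi>)"
    then obtain a where a: "a \<in> univ M" "eventually (\<lambda>N. sat N (urep a N # map (\<lambda>q. urep q N) e) \<phi>) U"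
      using IH by auto
    from a(1) have "eventually (\<lambda>N. urep a N \<in> univ N) U" by (simp add: univ_ultraproduct_iff)
    with a(2) show "eventually (\<lambda>N. sat N (map (\<lambda>q. urep q N) e) (FEx \<phi>)) U"
      by eventually_elim auto
  next
    assume ex: "eventually (\<lambda>N. sat N (map (\<lambda>q. urep q N) e) (FEx \<phi>)) U"
    define g where "g N = (SOME a. a \<in> univ N \<and> sat N (a # map (\<lambda>q. urep q N) e) \<phi>)" for N
    from ex have g: "eventually (\<lambda>N. g N \<in> univ N \<and> sat N (g N # map (\<lambda>q. urep q N) e) \<phi>) U"
    proof eventually_elim
      case (elim N)
      then have "\<exists>a. a \<in> univ N \<and> sat N (a # map (\<lambda>q. urep q N) e) \<phi>" by auto
      then show ?case unfolding g_def by (rule someI_ex)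
    qed
    then have "ucls U g \<in> univ M" by (auto simp: ultraproduct_def elim: eventually_mono)
    moreover from g ev_urep_ucls[of U g]
    have "eventually (\<lambda>N. sat N (urep (ucls U g) N # map (\<lambda>q. urep q N) e) \<phi>) U"
      by eventually_elim simp
    ultimately show "sat M e (FEx \<phi>)" using IH by auto
  qed
qed

text \<open>Finitely many distinct elements of \<open>M\<close> have representatives that are
  distinct in almost all structures.\<close>

lemma ev_card_univ: "eventually (\<lambda>N. n \<le> card (univ N)) U"
proof -
  obtain S where S: "S \<subseteq> univ M" "finite S" "card S = n"
    using infinite_arbitrarily_large[OF infinite_univ] by blast
  have "eventually (\<lambda>N. \<forall>q\<in>S. \<forall>q'\<in>S. q \<noteq> q' \<longrightarrow> urep q N \<noteq> urep q' N) U"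
  proof (intro eventually_ball_finite ballI S(2))
    fix q q' assume "q \<in> S" "q' \<in> S"
    then have "q \<in> range (ucls U)" "q' \<in> range (ucls U)"
      using S(1) by (auto simp: univ_ultraproduct_iff)
    then show "eventually (\<lambda>N. q \<noteq> q' \<longrightarrow> urep q N \<noteq> urep q' N) U"
      using range_ucls_eq_iff[of q U q'] by (cases "q = q'") (auto simp: ev_not_iff)
  qed
  moreover have "eventually (\<lambda>N. \<forall>q\<in>S. urep q N \<in> univ N) U"
    using S by (intro eventually_ball_finite) (auto simp: univ_ultraproduct_iff)
  ultimately show ?thesis using ev_finite
  proof eventually_elim
    case (elim N)
    then have "inj_on (\<lambda>q. urep q N) S" by (auto intro: inj_onI)
    then have "n = card ((\<lambda>q. urep q N) ` S)" using S by (simp add: card_image)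
    also have "\<dots> \<le> card (univ N)" using elim by (intro card_mono) auto
    finally show ?case .
  qed
qed

lemma ev_nonempty: "eventually (\<lambda>N. univ N \<noteq> {}) U"
  using ev_card_univ[of 1] by eventually_elim auto

text \<open>Tuples chosen separately in the structures are gathered into one tuple of
  \<open>M\<close>.\<close>

definition tuple_cls :: "nat \<Rightarrow> (('f, 'r, 'a) struct \<Rightarrow> 'a list) \<Rightarrow>
    (('f, 'r, 'a) struct \<Rightarrow> 'a) set list" where
  "tuple_cls n V = map (\<lambda>j. ucls U (\<lambda>N. V N ! j)) [0..<n]"

lemma tuple_cls:
  assumes "eventually (\<lambda>N. V N \<in> tuples N n) U"
  shows "tuple_cls n V \<in> tuples M n"
    and "eventually (\<lambda>N. map (\<lambda>q. urep q N) (tuple_cls n V) = V N) U"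
proof -
  have "ucls U (\<lambda>N. V N ! j) \<in> univ M" if "j < n" for j
  proof -
    from assms have "eventually (\<lambda>N. V N ! j \<in> univ N) U"
      by eventually_elim (use that in \<open>auto simp: tuples_def\<close>)
    then show ?thesis by (auto simp: ultraproduct_def)
  qed
  then show "tuple_cls n V \<in> tuples M n" by (auto simp: tuples_def tuple_cls_def)
  have "eventually (\<lambda>N. \<forall>j\<in>{..<n}. urep (ucls U (\<lambda>N. V N ! j)) N = V N ! j) U"
    by (intro eventually_ball_finite ballI ev_urep_ucls) simp
  with assms show "eventually (\<lambda>N. map (\<lambda>q. urep q N) (tuple_cls n V) = V N) U"
    by eventually_elim (auto simp: tuple_cls_def tuples_def intro!: nth_equalityI)
qed

text \<open>By maximality of \<open>U\<close> the inclusion would otherwise fail almost everywhere;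
  points of the differences, gathered into a tuple of \<open>M\<close>, would then contradict the
  inclusion in \<open>M\<close>.\<close>

lemma ev_def_set_mono:
  assumes "set a \<subseteq> univ M" "is_fmla L (r + length a) \<phi>"
    and "set b \<subseteq> univ M" "is_fmla L (r + length b) \<psi>"
    and sub: "def_set M r \<phi> a \<subseteq> def_set M r \<psi> b"
  shows "eventually (\<lambda>N. def_set N r \<phi> (map (\<lambda>q. urep q N) a)
    \<subseteq> def_set N r \<psi> (map (\<lambda>q. urep q N) b)) U"
proof (rule ccontr)
  let ?D = "\<lambda>N. def_set N r \<phi> (map (\<lambda>q. urep q N) a) - def_set N r \<psi> (map (\<lambda>q. urep q N) b)"
  assume "\<not> ?thesis"
  then have ev: "eventually (\<lambda>N. ?D N \<noteq> {}) U" by (simp add: ev_not_iff[symmetric])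
  define V where "V N = (SOME v. v \<in> ?D N)" for N
  from ev have V: "eventually (\<lambda>N. V N \<in> ?D N) U"
    unfolding V_def by eventually_elim (rule someI_ex, blast)
  then have "eventually (\<lambda>N. V N \<in> tuples N r) U" by eventually_elim (simp add: def_set_def)
  note tup = tuple_cls[OF this]
  let ?v = "tuple_cls r V"
  have v: "length ?v = r" "set ?v \<subseteq> univ M" using tup(1) by (auto simp: tuples_def)
  from V tup(2) have "eventually (\<lambda>N. sat N (map (\<lambda>q. urep q N) (?v @ a)) \<phi>) U"
    by eventually_elim (simp add: def_set_def)
  then have "?v \<in> def_set M r \<phi> a"
    using los[of "?v @ a" L \<phi>] v tup(1) assms by (simp add: def_set_def)
  then have "sat M (?v @ b) \<psi>" using sub by (auto simp: def_set_def)
  then have "eventually (\<lambda>N. sat N (map (\<lambda>q. urep q N) (?v @ b)) \<psi>) U"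
    using los[of "?v @ b" L \<psi>] v assms by simp
  with V tup(2) have "eventually (\<lambda>N. False) U"
    by eventually_elim (simp add: def_set_def)
  then show False using not_bot by simp
qed

lemma ev_finite_def_set: "eventually (\<lambda>N. finite (def_set N r \<phi> (b N))) U"
  using ev_finite
proof eventually_elim
  case (elim N)
  show ?case
  proof (rule finite_subset)
    show "finite {v. set v \<subseteq> univ N \<and> length v = r}" using elim by (rule finite_lists_length_eq)
  qed (auto simp: def_set_def tuples_def)
qed

text \<open>Every definable superset has at least the same cardinality in almost all structures, so
  \<open>delta U r \<phi> a\<close> belongs to the cut of its own set. It does not belong to the cut
  of the smaller set, which is bounded by \<open>delta U r \<psi> b\<close>.\<close>

lemma delta_set_less:
  assumes "set a \<subseteq> univ M" "is_fmla L (r + length a) \<phi>"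
    and "set b \<subseteq> univ M" "is_fmla L (r + length b) \<psi>"
    and sub: "def_set M r \<psi> b \<subseteq> def_set M r \<phi> a"
    and less: "\<not> dim_le U (delta U r \<phi> a) (delta U r \<psi> b)"
  shows "delta_set L U r (def_set M r \<psi> b) \<subset> delta_set L U r (def_set M r \<phi> a)"
proof -
  \<comment> \<open>\<open>None\<close> lies below every dimension, so \<open>less\<close> excludes
    it here.\<close>
  obtain q where q: "delta U r \<phi> a = Some q" using less by (cases "delta U r \<phi> a") auto
  have "q \<in> delta_set L U r (def_set M r \<phi> a)"
    unfolding delta_set_def
  proof (intro CollectI conjI allI impI)
    show "q \<in> cosets U" using q by (auto simp: delta_eq_dim_of dim_of_Some_in_cosets)
    fix \<theta> c assume c: "set c \<subseteq> univ M \<and> is_fmla L (r + length c) \<theta> \<and>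
        def_set M r \<phi> a \<subseteq> def_set M r \<theta> c"
    have "eventually (\<lambda>N. def_set N r \<phi> (map (\<lambda>q. urep q N) a)
        \<subseteq> def_set N r \<theta> (map (\<lambda>q. urep q N) c)) U"
      using ev_def_set_mono[OF assms(1,2)] c by blast
    with ev_finite_def_set[of r \<theta> "\<lambda>N. map (\<lambda>q. urep q N) c"]
    have "eventually (\<lambda>N. count r \<phi> a N \<le> 1 * count r \<theta> c N) U"
      by eventually_elim (simp add: count_def card_mono)
    then show "dim_le U (Some q) (delta U r \<theta> c)"
      unfolding q[symmetric] delta_eq_dim_of
      by (subst dim_le_dim_of_iff) (simp_all only: count_def of_nat_0_le_iff, blast)
  qed
  moreover have "q \<notin> delta_set L U r (def_set M r \<psi> b)"
    using less assms(3,4) unfolding q by (auto simp: delta_set_def)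
  moreover have "delta_set L U r (def_set M r \<psi> b) \<subseteq> delta_set L U r (def_set M r \<phi> a)"
    using sub by (fastforce simp: delta_set_def)
  ultimately show ?thesis by blast
qed

section \<open>From trees in \<open>M\<close> to a failure of (A)\<close>

lemma has_tree_imp_ev_has_tree:
  assumes "is_fmla L (r + s) \<phi>" "has_tree M r s \<phi> w ks []"
  shows "eventually (\<lambda>N. has_tree N r s \<phi> w ks []) U"
proof -
  have "univ M \<noteq> {}" using infinite_univ by auto
  then have "sat M [] (tree_fm r s \<phi> w ks 0)"
    using sat_tree_fm[OF assms(1), of M "[]" w ks] assms(2) by simp
  then have "eventually (\<lambda>N. sat N [] (tree_fm r s \<phi> w ks 0)) U"
    using los[of "[]" L] is_fmla_tree_fm[OF assms(1), of 0 w ks] by simp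
  with ev_nonempty show ?thesis
    by eventually_elim (use sat_tree_fm[OF assms(1), of _ "[]" w ks] in fastforce)
qed

text \<open>The number \<open>n\<close> is both the length and the shrinking factor, so that letting
  one parameter grow controls both.\<close>

definition shrinking :: "nat \<Rightarrow> nat \<Rightarrow> ('f, 'r) fm \<Rightarrow> nat \<Rightarrow> ('f, 'r, 'a) struct \<Rightarrow> 'a list list \<Rightarrow> bool" where
  "shrinking r s \<phi> n N zs \<longleftrightarrow> length zs = n \<and> set zs \<subseteq> tuples N s \<and>
     solutions N r \<phi> (set zs) \<noteq> {} \<and>
     (\<forall>j<n. n * card (solutions N r \<phi> (set (take (Suc j) zs)))
       < card (solutions N r \<phi> (set (take j zs))))"

lemma has_tree_imp_ev_shrinking:
  assumes "is_fmla L (r + s) \<phi>" "length ks = n" "\<And>w. has_tree M r s \<phi> w ks []"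
  shows "eventually (\<lambda>N. \<exists>zs. shrinking r s \<phi> n N zs) U"
proof -
  \<comment> \<open>The degrees are fixed before the width, so \<open>w\<close> can be chosen above
    every \<open>n * k\<close>.\<close>
  define w where "w = Suc (n * sum_list ks)"
  have w: "0 < w" "\<forall>k\<in>set ks. n * k < w"
    by (auto simp: w_def less_Suc_eq_le intro: mult_le_mono2 member_le_sum_list)
  have "eventually (\<lambda>N. has_tree N r s \<phi> w ks []) U"
    using assms by (intro has_tree_imp_ev_has_tree)
  with ev_finite show ?thesis
  proof eventually_elim
    case (elim N)
    then show ?case
      using has_tree_imp_shrinking_branch[OF elim(1) w elim(2)] assms(2)
      by (auto simp: shrinking_def)
  qed
qed

text \<open>Since \<open>card (univ N)\<close> is unbounded along \<open>U\<close>, it can serve to cut off the lengths of the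
  shrinking sequences in a diagonal argument, which replaces the saturation of \<open>K\<^sup>*\<close>.\<close>

lemma ev_shrinking_diagonal:
  assumes "\<And>n. eventually (\<lambda>N. \<exists>zs. shrinking r s \<phi> n N zs) U"
  obtains \<nu> Z where "\<And>n. eventually (\<lambda>N. n \<le> \<nu> N \<and> shrinking r s \<phi> (\<nu> N) N (Z N)) U"
proof -
  define S where "S N = {n. n \<le> card (univ N) \<and> (\<exists>zs. shrinking r s \<phi> n N zs)}" for N
  \<comment> \<open>The cut-off makes \<open>S N\<close> finite. Each fixed \<open>n\<close> lies in
    \<open>S N\<close> for almost all \<open>N\<close>, so the maxima reach \<open>n\<close> almost
    everywhere.\<close>
  define \<nu> where "\<nu> N = Max (S N)" for N
  define Z where "Z N = (SOME zs. shrinking r s \<phi> (\<nu> N) N zs)" for N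
  have "eventually (\<lambda>N. n \<le> \<nu> N \<and> shrinking r s \<phi> (\<nu> N) N (Z N)) U" for n
    using assms[of n] ev_card_univ[of n]
  proof eventually_elim
    case (elim N)
    have fin: "finite (S N)" by (simp add: S_def)
    have n: "n \<in> S N" using elim by (simp add: S_def)
    then have "\<nu> N \<in> S N" unfolding \<nu>_def using fin by (intro Max_in) auto
    then have "shrinking r s \<phi> (\<nu> N) N (Z N)" unfolding Z_def by (auto simp: S_def intro: someI_ex)
    moreover have "n \<le> \<nu> N" unfolding \<nu>_def using fin n by (intro Max_ge)
    ultimately show ?case by simp
  qed
  then show thesis by (rule that)
qed

text \<open>The \<open>j\<close>-th entries of the sequences \<open>Z N\<close> define a tuple
  \<open>a j\<close> of \<open>M\<close> for every natural number \<open>j\<close>. Adding one more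
  tuple shrinks the number of solutions by a factor above \<open>\<nu> N\<close>, which exceeds
  every constant almost everywhere, so the dimension drops.\<close>

lemma has_tree_imp_not_cond_A:
  assumes \<phi>: "is_fmla L (r + s) \<phi>"
    and trees: "\<And>n. \<exists>ks. length ks = n \<and> (\<forall>w. has_tree M r s \<phi> w ks [])"
  shows "\<not> cond_A L U"
proof -
  have "eventually (\<lambda>N. \<exists>zs. shrinking r s \<phi> n N zs) U" for n
    using trees[of n] has_tree_imp_ev_shrinking[OF \<phi>] by blast
  then obtain \<nu> Z where Z: "\<And>n. eventually (\<lambda>N. n \<le> \<nu> N \<and> shrinking r s \<phi> (\<nu> N) N (Z N)) U"
    using ev_shrinking_diagonal by blast
  \<comment> \<open>\<open>Z N\<close> has more than \<open>j\<close> entries once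
    \<open>Suc j \<le> \<nu> N\<close>.\<close>
  have Zj: "eventually (\<lambda>N. Z N ! j \<in> tuples N s) U" for j
    using Z[of "Suc j"]
  proof eventually_elim
    case (elim N)
    then have "Z N ! j \<in> set (Z N)" by (simp add: shrinking_def)
    then show ?case using elim unfolding shrinking_def by blast
  qed
  define a where "a j = tuple_cls s (\<lambda>N. Z N ! j)" for j
  note a = tuple_cls[OF Zj, folded a_def]
  define p where "p i = a ` {..<i}" for i
  define \<psi> where "\<psi> i = sol_fm r s \<phi> [0..<i]" for i
  define c where "c i = concat (map a [0..<i])" for i
  have len: "\<forall>y\<in>set (map a [0..<i]). length y = s" for i using a(1) by (auto simp: tuples_def)
  have c: "set (c i) \<subseteq> univ M" "is_fmla L (r + length (c i)) (\<psi> i)" for i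
  proof -
    show "set (c i) \<subseteq> univ M" using a(1) by (force simp: c_def tuples_def)
    show "is_fmla L (r + length (c i)) (\<psi> i)"
      using is_fmla_sol_fm[OF \<phi>, of "[0..<i]" i] length_concat_uniform[OF len, of i]
      by (simp add: c_def \<psi>_def)
  qed
  have M: "univ M \<noteq> {}" using infinite_univ by auto
  have sol: "solutions M r \<phi> (p i) = def_set M r (\<psi> i) (c i)" for i
    using solutions_eq_def_set[OF \<phi> len M, of i] by (simp add: p_def \<psi>_def c_def lessThan_atLeast0)
  have ev_sol: "eventually (\<lambda>N. def_set N r (\<psi> i) (map (\<lambda>q. urep q N) (c i)) =
      solutions N r \<phi> (set (take i (Z N)))) U" for i
  proof -
    have "eventually (\<lambda>N. \<forall>j\<in>{..<i}. map (\<lambda>q. urep q N) (a j) = Z N ! j) U"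
      by (intro eventually_ball_finite ballI a(2)) simp
    with Z[of i] ev_nonempty show ?thesis
    proof eventually_elim
      case (elim N)
      have i: "i \<le> length (Z N)" using elim by (simp add: shrinking_def)
      have "map (\<lambda>q. urep q N) (c i) = concat (take i (Z N))"
        using elim(3) i unfolding c_def map_concat
        by (intro arg_cong[where f = concat] nth_equalityI) auto
      moreover have "\<forall>y\<in>set (take i (Z N)). length y = s"
        using elim(1) by (auto simp: shrinking_def tuples_def dest: in_set_takeD)
      ultimately show ?case
        using solutions_eq_def_set[OF \<phi> _ elim(2), of "take i (Z N)"] i by (simp add: \<psi>_def min_absorb2)
    qed
  qed
  have "consistent M r \<phi> (p i)" for i
  proof -
    have "def_set M r (\<psi> i) (c i) \<noteq> {}"
    proof
      assume "def_set M r (\<psi> i) (c i) = {}"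
      \<comment> \<open>An empty set is contained in its complement; this inclusion passes to almost
        all structures, where it again says that the set is empty.\<close>
      then have "eventually (\<lambda>N. def_set N r (\<psi> i) (map (\<lambda>q. urep q N) (c i))
          \<subseteq> def_set N r (FNeg (\<psi> i)) (map (\<lambda>q. urep q N) (c i))) U"
        using c by (intro ev_def_set_mono[where L = L]) auto
      with ev_sol[of i] Z[of i] have "eventually (\<lambda>N. False) U"
      proof eventually_elim
        case (elim N)
        have "solutions N r \<phi> (set (Z N)) \<subseteq> solutions N r \<phi> (set (take i (Z N)))"
          by (auto simp: solutions_def dest: in_set_takeD)
        then show ?case using elim by (auto simp: def_set_def shrinking_def)
      qed
      then show False using not_bot by simp
    qed
    then show ?thesis unfolding sol[symmetric] by (simp add: consistent_finite p_def)
  qed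
  moreover have "delta_set L U r (solutions M r \<phi> (p (Suc i))) \<subset> delta_set L U r (solutions M r \<phi> (p i))" for i
    unfolding sol
  proof (rule delta_set_less[OF c c])
    have "solutions M r \<phi> (p (Suc i)) \<subseteq> solutions M r \<phi> (p i)"
      by (auto simp: solutions_def p_def)
    then show "def_set M r (\<psi> (Suc i)) (c (Suc i)) \<subseteq> def_set M r (\<psi> i) (c i)" unfolding sol .
    have False if "eventually (\<lambda>N. count r (\<psi> i) (c i) N \<le> C * count r (\<psi> (Suc i)) (c (Suc i)) N) U" for C
    proof -
      obtain n where n: "C \<le> real n" using real_arch_simple by blast
      \<comment> \<open>\<open>n\<close> makes the factor at least \<open>C\<close>, and
        \<open>Suc i\<close> makes the sequence long enough to have a step \<open>i\<close>.\<close>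
      from that ev_sol[of i] ev_sol[of "Suc i"] Z[of "max n (Suc i)"] have "eventually (\<lambda>N. False) U"
      proof eventually_elim
        case (elim N)
        let ?k = "\<lambda>i. card (solutions N r \<phi> (set (take i (Z N))))"
        have "real (?k i) \<le> C * real (?k (Suc i))" using elim by (simp add: count_def)
        also have "\<dots> \<le> real (\<nu> N) * real (?k (Suc i))"
          using n elim(4) by (intro mult_right_mono) auto
        finally have "?k i \<le> \<nu> N * ?k (Suc i)" by (simp flip: of_nat_mult)
        moreover have "\<nu> N * ?k (Suc i) < ?k i" using elim(4) by (simp add: shrinking_def)
        ultimately show ?case by simp
      qed
      then show False using not_bot by simp
    qed
    then show "\<not> dim_le U (delta U r (\<psi> i) (c i)) (delta U r (\<psi> (Suc i)) (c (Suc i)))"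
      unfolding delta_eq_dim_of by (subst dim_le_dim_of_iff) (auto simp: count_def)
  qed
  moreover have "finite (p i)" "p i \<subseteq> tuples M s" "p i \<subseteq> p (Suc i)" for i
    using a(1) by (auto simp: p_def)
  ultimately have "\<exists>p. \<forall>i. finite (p i) \<and> p i \<subseteq> tuples M s \<and> consistent M r \<phi> (p i) \<and>
      p i \<subseteq> p (Suc i) \<and> delta_set L U r (solutions M r \<phi> (p (Suc i)))
        \<subset> delta_set L U r (solutions M r \<phi> (p i))"
    by (intro exI[of _ p]) simp
  then show ?thesis
    unfolding cond_A_def Let_def using \<phi> by blast
qed

section \<open>Transfer from models of the theory to \<open>M\<close>\<close>

lemma sat_model_transfer:
  assumes "is_model L (Th L M) N" "is_fmla L 0 \<sigma>" "sat N [] \<sigma>"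
  shows "sat M [] \<sigma>"
proof (rule ccontr)
  assume "\<not> sat M [] \<sigma>"
  then have "FNeg \<sigma> \<in> Th L M" using assms(2) by (simp add: Th_def)
  then have "sat N [] (FNeg \<sigma>)" using assms(1) by (auto simp: is_model_def)
  then show False using assms(3) by simp
qed

text \<open>A tree with empty path is described by a sentence, and the theory of \<open>M\<close>
  decides every sentence. So trees found in any model can be confronted with (A), which speaks of
  \<open>M\<close> only.\<close>

lemma has_tree_model_transfer:
  assumes "is_model L (Th L M) N" "is_fmla L (r + s) \<phi>" "has_tree N r s \<phi> w ks []"
  shows "has_tree M r s \<phi> w ks []"
proof -
  have ne: "univ N \<noteq> {}" "univ M \<noteq> {}"
    using assms(1) infinite_univ by (auto simp: is_model_def is_structure_def)
  have "sat N [] (tree_fm r s \<phi> w ks 0)"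
    using sat_tree_fm[OF assms(2) ne(1), of "[]" w ks] assms(3) by simp
  then have "sat M [] (tree_fm r s \<phi> w ks 0)"
    using sat_model_transfer[OF assms(1)] is_fmla_tree_fm[OF assms(2), of 0 w ks] by simp
  then show ?thesis using sat_tree_fm[OF assms(2) ne(2), of "[]" w ks] by simp
qed

lemma cond_A_imp_simple:
  assumes "cond_A L U"
  shows "simple_theory TYPE('m) L (Th L M)"
  unfolding simple_theory_def
proof (intro allI impI notI)
  fix N :: "('f, 'r, 'm) struct" and r s \<phi>
  assume N: "is_model L (Th L M) N" and \<phi>: "is_fmla L (r + s) \<phi>" and "tree_property N r s \<phi>"
  then obtain k a where "\<And>\<sigma>. a \<sigma> \<in> tuples N s"
    "\<And>\<eta> :: nat \<Rightarrow> nat. consistent N r \<phi> {a (map \<eta> [0..<n]) | n. True}"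
    "\<And>\<sigma>. k_inconsistent N r \<phi> k (\<lambda>i. a (\<sigma> @ [i]))"
    unfolding tree_property_def by blast
  note tree_property_imp_has_tree[where ys = "[]", OF this]
  then have "has_tree N r s \<phi> w (replicate n k) []" for w n by simp
  then have "has_tree M r s \<phi> w (replicate n k) []" for w n
    using has_tree_model_transfer[OF N \<phi>] by blast
  then have "\<exists>ks. length ks = n \<and> (\<forall>w. has_tree M r s \<phi> w ks [])" for n
    by (intro exI[of _ "replicate n k"]) simp
  then show False using has_tree_imp_not_cond_A[OF \<phi>] assms by blast
qed

text \<open>Without a bound, chains of every length exist, possibly each in a different model; their
  trees all transfer to \<open>M\<close>, where (A) rules them out.\<close>

lemma cond_A_imp_low:
  assumes "cond_A L U"
  shows "low_theory TYPE('m) L (Th L M)"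
  unfolding low_theory_def
proof (intro conjI allI impI cond_A_imp_simple assms, rule ccontr)
  fix r s \<phi>
  assume \<phi>: "is_fmla L (r + s) \<phi>"
    and "\<nexists>n. \<forall>N :: ('f, 'r, 'm) struct. is_model L (Th L M) N \<and> omega1_saturated L N \<longrightarrow>
      \<not> (\<exists>a. dividing_chain L N r s \<phi> n a)"
  then have chain: "\<exists>(N :: ('f, 'r, 'm) struct) a. is_model L (Th L M) N \<and> dividing_chain L N r s \<phi> n a" for n
    by blast
  have "\<exists>ks. length ks = n \<and> (\<forall>w. has_tree M r s \<phi> w ks [])" for n
  proof -
    obtain N :: "('f, 'r, 'm) struct" and a where N: "is_model L (Th L M) N" "dividing_chain L N r s \<phi> n a"
      using chain by blast
    then have "univ N \<noteq> {}" by (auto simp: is_model_def is_structure_def)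
    then show ?thesis
      using dividing_chain_imp_has_tree[OF \<phi> _ N(2)] has_tree_model_transfer[OF N(1) \<phi>] by blast
  qed
  then show False using has_tree_imp_not_cond_A[OF \<phi>] assms by blast
qed

end

section \<open>Chains in definable preorders\<close>

text \<open>The elements are sorted by their number of predecessors; by transitivity and
  antisymmetry a strictly smaller element has strictly fewer of them.\<close>

lemma finite_total_order_chain:
  assumes "finite S" and lin: "\<And>x y. x \<in> S \<Longrightarrow> y \<in> S \<Longrightarrow> R x y \<or> R y x"
    and anti: "\<And>x y. x \<in> S \<Longrightarrow> y \<in> S \<Longrightarrow> R x y \<Longrightarrow> R y x \<Longrightarrow> x = y"
    and trans: "\<And>x y z. x \<in> S \<Longrightarrow> y \<in> S \<Longrightarrow> z \<in> S \<Longrightarrow> R x y \<Longrightarrow> R y z \<Longrightarrow> R x z"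
  obtains f :: "nat \<Rightarrow> 'b" where "\<And>i. i < card S \<Longrightarrow> f i \<in> S"
    "\<And>i j. i < j \<Longrightarrow> j < card S \<Longrightarrow> \<not> R (f j) (f i)"
proof -
  obtain xs where xs: "set xs = S" "distinct xs" using finite_distinct_list[OF assms(1)] by blast
  define rank where "rank x = card {y\<in>S. R y x}" for x
  have less: "rank x < rank y" if "x \<in> S" "y \<in> S" "R x y" "x \<noteq> y" for x y
    unfolding rank_def
  proof (rule psubset_card_mono)
    show "{z\<in>S. R z x} \<subset> {z\<in>S. R z y}"
      using that lin[of y y] anti[of x y] trans[of _ x y] by blast
  qed (use assms(1) in simp)
  let ?xs = "sort_key rank xs"
  have len: "length ?xs = card S" using xs distinct_card[of xs] by simp
  show thesis
  proof (rule that[of "\<lambda>i. ?xs ! i"])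
    fix i assume "i < card S"
    then show in_S: "?xs ! i \<in> S" using len xs nth_mem[of i ?xs] by simp
  next
    fix i j assume ij: "i < j" "j < card S"
    have S: "?xs ! i \<in> S" "?xs ! j \<in> S" using ij len xs nth_mem[of _ ?xs] by auto
    have "?xs ! i \<noteq> ?xs ! j" using ij len xs(2) by (simp add: nth_eq_iff_index_eq)
    moreover have "rank (?xs ! i) \<le> rank (?xs ! j)"
      using sorted_nth_mono[OF sorted_sort_key[of rank xs], of i j] ij len by simp
    ultimately show "\<not> R (?xs ! j) (?xs ! i)" using less[of "?xs ! j" "?xs ! i"] S by auto
  qed
qed

text \<open>\<open>interval_fm s \<chi>\<close> is \<open>y\<^sub>1 \<le> x < y\<^sub>2\<close> for the preorder \<open>\<chi>(y,z)\<close> on \<open>s\<close>-tuples.\<close>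

definition interval_fm :: "nat \<Rightarrow> ('f, 'r) fm \<Rightarrow> ('f, 'r) fm" where
  "interval_fm s \<chi> = FConj (ren (\<lambda>v. if v < s then v + s else v - s) \<chi>)
     (FNeg (ren (\<lambda>v. if v < s then v + 2 * s else v - s) \<chi>))"

lemma is_fmla_interval_fm:
  "is_fmla L (s + s) \<chi> \<Longrightarrow> is_fmla L (s + 2 * s) (interval_fm s \<chi>)"
  by (auto simp: interval_fm_def intro!: is_fmla_ren)

lemma sat_interval_fm:
  assumes "is_fmla L (s + s) \<chi>" "length x = s" "length y = s" "length z = s"
  shows "sat N (x @ y @ z) (interval_fm s \<chi>) \<longleftrightarrow> sat N (y @ x) \<chi> \<and> \<not> sat N (z @ x) \<chi>"
proof -
  have "sat N (x @ y @ z) (ren (\<lambda>v. if v < s then v + s else v - s) \<chi>) \<longleftrightarrow> sat N (y @ x) \<chi>"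
    by (rule sat_ren[OF assms(1)]) (use assms in \<open>auto simp: nth_append\<close>)
  moreover have "sat N (x @ y @ z) (ren (\<lambda>v. if v < s then v + 2 * s else v - s) \<chi>) \<longleftrightarrow> sat N (z @ x) \<chi>"
    by (rule sat_ren[OF assms(1)]) (use assms in \<open>auto simp: nth_append\<close>)
  ultimately show ?thesis by (simp add: interval_fm_def)
qed

text \<open>An interval with \<open>w\<^sup>n\<close> elements splits into \<open>w\<close> disjoint ones with \<open>w\<^sup>n\<^sup>-\<^sup>1\<close> elements each.\<close>

lemma chain_imp_has_tree:
  assumes \<chi>: "is_fmla L (s + s) \<chi>"
    and f: "\<And>i. i < K \<Longrightarrow> f i \<in> tuples N s"
    and chain: "\<And>i j. i < K \<Longrightarrow> j < K \<Longrightarrow> sat N (f i @ f j) \<chi> \<longleftrightarrow> i \<le> j"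
    and trans: "\<And>x y z. x \<in> tuples N s \<Longrightarrow> y \<in> tuples N s \<Longrightarrow> z \<in> tuples N s \<Longrightarrow>
      sat N (x @ y) \<chi> \<Longrightarrow> sat N (y @ z) \<chi> \<Longrightarrow> sat N (x @ z) \<chi>"
  shows "l + w ^ n < K \<Longrightarrow> {f j | j. l \<le> j \<and> j < l + w ^ n} \<subseteq> solutions N s (interval_fm s \<chi>) (set ys) \<Longrightarrow>
    has_tree N s (2 * s) (interval_fm s \<chi>) w (replicate n 2) ys"
proof (induction n arbitrary: l ys)
  case 0
  then have "f l \<in> solutions N s (interval_fm s \<chi>) (set ys)" by fastforce
  then show ?case by auto
next
  case (Suc n)
  let ?d = "w ^ n"
  \<comment> \<open>Consecutive subintervals share an endpoint. The last right end is at
    \<open>l + w ^ Suc n\<close>, which is why this index has to be below \<open>K\<close>.\<close>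
  let ?z = "\<lambda>i. f (l + i * ?d) @ f (l + Suc i * ?d)"
  let ?zs = "map ?z [0..<w]"
  have bd: "l + Suc i * ?d \<le> l + w ^ Suc n" if "i < w" for i
    using mult_le_mono1[of "Suc i" w ?d] that by simp
  have sat_z: "sat N (v @ ?z i) (interval_fm s \<chi>) \<longleftrightarrow>
      sat N (f (l + i * ?d) @ v) \<chi> \<and> \<not> sat N (f (l + Suc i * ?d) @ v) \<chi>"
    if "i < w" "v \<in> tuples N s" for v i
    using sat_interval_fm[OF \<chi>, of v "f (l + i * ?d)" "f (l + Suc i * ?d)" N] that bd[of i]
      f[of "l + i * ?d"] f[of "l + Suc i * ?d"] Suc.prems(1)
    by (auto simp: tuples_def)
  have "has_tree N s (2 * s) (interval_fm s \<chi>) w (replicate n 2) (?z i # ys)" if i: "i < w" for i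
  proof (rule Suc.IH[of "l + i * ?d"])
    show lt: "l + i * ?d + ?d < K" using bd[OF i] Suc.prems(1) by simp
    show "{f j | j. l + i * ?d \<le> j \<and> j < l + i * ?d + ?d}
        \<subseteq> solutions N s (interval_fm s \<chi>) (set (?z i # ys))"
    proof safe
      fix j assume j: "l + i * ?d \<le> j" "j < l + i * ?d + ?d"
      then have jK: "j < K" using lt by simp
      have "f j \<in> solutions N s (interval_fm s \<chi>) (set ys)"
        using Suc.prems(2) j bd[OF i] by force
      moreover have "sat N (f j @ ?z i) (interval_fm s \<chi>)"
        using sat_z[OF i f[OF jK]] chain[of "l + i * ?d" j] chain[of "l + Suc i * ?d" j] j jK lt
        by (simp add: algebra_simps)
      ultimately show "f j \<in> solutions N s (interval_fm s \<chi>) (set (?z i # ys))"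
        by (simp add: solutions_def)
    qed
  qed
  moreover have "solutions N s (interval_fm s \<chi>) ((!) ?zs ` I) = {}" if I: "I \<subseteq> {..<w}" "card I = 2" for I
  proof (rule ccontr)
    assume "\<not> ?thesis"
    then obtain v where v: "v \<in> tuples N s" "\<And>i. i \<in> I \<Longrightarrow> sat N (v @ ?zs ! i) (interval_fm s \<chi>)"
      by (auto simp: solutions_def)
    obtain i j where ij: "i \<in> I" "j \<in> I" "i < j"
      using I(2) by (metis card_2_iff insertCI linorder_neqE_nat)
    then have w: "i < w" "j < w" using I by auto
    \<comment> \<open>\<open>v\<close> is above the left end of the later interval, hence by
      transitivity above the right end of the earlier one.\<close>
    have "\<not> sat N (f (l + Suc i * ?d) @ v) \<chi>" "sat N (f (l + j * ?d) @ v) \<chi>"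
      using v(2)[OF ij(1)] v(2)[OF ij(2)] sat_z[OF w(1) v(1)] sat_z[OF w(2) v(1)] w by auto
    moreover have le: "l + Suc i * ?d \<le> l + j * ?d"
      using mult_le_mono1[of "Suc i" j ?d] ij by simp
    moreover have "l + Suc i * ?d < K" "l + j * ?d < K"
      using bd[OF w(2)] Suc.prems(1) le by auto
    ultimately show False
      using chain[of "l + Suc i * ?d" "l + j * ?d"] trans[OF f f v(1)] by blast
  qed
  moreover have "set ?zs \<subseteq> tuples N (2 * s)"
  proof -
    have "?z i \<in> tuples N (2 * s)" if "i < w" for i
      using bd[OF that] Suc.prems(1) f[of "l + i * ?d"] f[of "l + Suc i * ?d"]
      by (auto simp: tuples_def)
    then show ?thesis by auto
  qed
  ultimately show ?case by (auto intro!: exI[of _ ?zs])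
qed

text \<open>(DC) with both formulas equal to \<phi> gives \<chi>. Infinitely many values yield
  chains of every finite length, and (A) is contradicted for \<open>interval_fm s \<chi>\<close>,
  whose parameters are pairs of endpoints, rather than for \<phi> itself.\<close>

lemma (in pseudofinite) cond_A_DC_imp_FMV:
  assumes "cond_A L U" "cond_DC L U"
  shows "cond_FMV L U"
  unfolding cond_FMV_def
proof (intro allI impI, rule ccontr)
  fix r s \<phi>
  assume \<phi>: "is_fmla L (r + s) \<phi>" and inf: "infinite (delta U r \<phi> ` tuples M s)"
  let ?R = "\<lambda>a b. dim_le U (delta U r \<phi> a) (delta U r \<phi> b)"
  obtain \<chi> where \<chi>: "is_fmla L (s + s) \<chi>"
    "\<And>a b. a \<in> tuples M s \<Longrightarrow> b \<in> tuples M s \<Longrightarrow> sat M (a @ b) \<chi> \<longleftrightarrow> ?R a b"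
    using assms(2) \<phi> unfolding cond_DC_def Let_def by meson
  have nn: "0 \<le> count r \<phi> a N" for a and N :: "('f, 'r, 'a) struct" by (simp add: count_def)
  have lin: "?R a b \<or> ?R b a" for a b
    unfolding delta_eq_dim_of by (rule dim_of_linear) (rule nn)+
  have trans: "?R a c" if "?R a b" "?R b c" for a b c
    using that unfolding delta_eq_dim_of by (rule dim_of_trans[rotated 3]) (rule nn)+
  have anti: "delta U r \<phi> a = delta U r \<phi> b" if "?R a b" "?R b a" for a b
    using that unfolding delta_eq_dim_of by (rule dim_of_antisym)
  have "has_tree M s (2 * s) (interval_fm s \<chi>) w (replicate n 2) []" for w n
  proof -
    \<comment> \<open>The one element beyond \<open>w ^ n\<close> is the right end of the last
      interval.\<close>
    define K where "K = Suc (w ^ n)"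
    obtain D where D: "D \<subseteq> delta U r \<phi> ` tuples M s" "finite D" "card D = K"
      using infinite_arbitrarily_large[OF inf] by blast
    \<comment> \<open>One tuple is kept for each value, so that the preorder \<open>?R\<close> is
      antisymmetric on \<open>S\<close>.\<close>
    then obtain S where S: "S \<subseteq> tuples M s" "inj_on (delta U r \<phi>) S" "D = delta U r \<phi> ` S"
      by (auto simp: subset_image_inj)
    have fin: "finite S" "card S = K" using D S by (auto simp: card_image finite_image_iff)
    obtain f where f: "\<And>i. i < K \<Longrightarrow> f i \<in> S" "\<And>i j. i < j \<Longrightarrow> j < K \<Longrightarrow> \<not> ?R (f j) (f i)"
    proof (rule finite_total_order_chain[of S ?R])
      fix a b assume "a \<in> S" "b \<in> S" "?R a b" "?R b a"
      then show "a = b" using anti[of a b] S(2) by (auto dest: inj_onD)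
    qed (use fin lin trans in auto)
    show ?thesis
    proof (rule chain_imp_has_tree[OF \<chi>(1), of K f M 0])
      show fM: "f i \<in> tuples M s" if "i < K" for i using f(1)[OF that] S(1) by blast
      fix i j assume ij: "i < K" "j < K"
      have "?R (f i) (f j) \<longleftrightarrow> i \<le> j"
        using f(2)[of j i] f(2)[of i j] lin[of "f i" "f j"] lin[of "f i" "f i"] ij
        by (cases i j rule: linorder_cases) auto
      then show "sat M (f i @ f j) \<chi> \<longleftrightarrow> i \<le> j" using \<chi>(2)[OF fM fM] ij by simp
    next
      fix x y z assume "x \<in> tuples M s" "y \<in> tuples M s" "z \<in> tuples M s"
        "sat M (x @ y) \<chi>" "sat M (y @ z) \<chi>"
      then show "sat M (x @ z) \<chi>" using \<chi>(2) trans[of x y z] by simp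
    next
      show "{f j |j. 0 \<le> j \<and> j < 0 + w ^ n} \<subseteq> solutions M s (interval_fm s \<chi>) (set [])"
        using f(1) S(1) by (auto simp: solutions_def K_def)
    qed (simp add: K_def)
  qed
  then have "\<exists>ks. length ks = n \<and> (\<forall>w. has_tree M s (2 * s) (interval_fm s \<chi>) w ks [])" for n
    by (intro exI[of _ "replicate n 2"]) simp
  then show False
    using has_tree_imp_not_cond_A[OF is_fmla_interval_fm[OF \<chi>(1)]] assms(1) by blast
qed

theorem theorem3p8:
  fixes L :: "('f, 'r) language"
    and \<C> :: "('f, 'r, 'a) struct set"
    and U :: "('f, 'r, 'a) struct filter"
  assumes "countable_language L"
    and "infinite \<C>"
    and "\<forall>N\<in>\<C>. is_structure L N \<and> finite (univ N)"
    and "nonprincipal_ultrafilter_on U \<C>"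
    and "infinite (univ (ultraproduct U))"
  shows "(cond_A L U \<longrightarrow>
            simple_theory TYPE('m) L (Th L (ultraproduct U)) \<and>
            low_theory TYPE('m) L (Th L (ultraproduct U))) \<and>
         (cond_A L U \<and> cond_DC L U \<longrightarrow> cond_FMV L U)"
proof -
  have "eventually (\<lambda>N. N \<in> \<C>) U"
    using assms(4) unfolding nonprincipal_ultrafilter_on_def
    by (metis le_principal)
  then have "eventually (\<lambda>N. finite (univ N)) U"
    by eventually_elim (use assms(3) in blast)
  then interpret pseudofinite U
    using assms(4,5) by unfold_locales (auto simp: nonprincipal_ultrafilter_on_def)
  show ?thesis
    using cond_A_imp_simple cond_A_imp_low cond_A_DC_imp_FMV by blast
qed

end
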